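(* Consider the one-warehouse, $K$-store inventory problem with backlogged demand described in the context. For a policy $\pi$ let $J_1^{\pi}$ be the expected total cost over periods $1,\dots,T$ incurred by $\pi$ from the initial state (zero inventory everywhere). There exists a finite constant $C=C(\overline p,\overline h,\underline p,\underline h,q,\kappa,\gamma^{L},\gamma^{H})$, depending only on the listed quantities, such that the following holds: there exists a $1$-round GNN (message-passing) policy $\tilde\pi$ satisfying $$\frac{J_1^{\tilde\pi}}{\inf_{\pi}J_1^{\pi}}\le 1+\frac{C}{\sqrt K},$$ where the infimum is over all feasible (non-anticipating) policies.
   Context: **Inventory problem.** Locations: a warehouse $w$ and stores $1,\dots,K$; write $[K]=\{1,\dots,K\}$ and $\mathcal N_+=\{w\}\cup[K]$. An external supplier (node $0$) with unlimited stock supplies the warehouse; the warehouse supplies all stores. The horizon is $T\ge1$. Store $k$ has underage cost $p^k\in[\underline p,\overline p]$ and holding cost $h^k\in[\underline h,\overline h]$, with $0<\underline p\le\overline p$, $0<\underline h\le\overline h$; the warehouse has holding cost $h^w\ge0$. Demand at store $k$ in period $t$ is $\xi_t^k=B_tU_t^k$, where $U_t^k\sim\mathrm{Uniform}(\underline u^k,\overline u^k)$ independently over stores and time, $\overline u^k\in[1/\kappa,\kappa]$ for all $k$, and, independently of the $U$'s and over time, $B_t=\gamma^H>0$ with probability $q\in(0,1)$ and $B_t=\gamma^L\in(0,\gamma^H)$ otherwise. Assumptions: (1) $\gamma^L\underline u^k\ge\gamma^H\overline u^k-\gamma^L\underline u^k$ for every $k$; (2) $q\,\underline p\ge(1-q)h^w$.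 State: on-hand inventories $I_t=(I_t^w,I_t^1,\dots,I_t^K)$ before ordering, with $I_1=0$ (store inventories may become negative, representing backlog). Action: $a_t=(a_t^w,a_t^1,\dots,a_t^K)\in\mathbb R_+^{K+1}$ with $\sum_{k\in[K]}a_t^k\le I_t^w$; $a_t^w$ is ordered from the supplier (lead time 1) and $a_t^k$ is shipped from the warehouse to store $k$ (lead time 0). Dynamics: $I_{t+1}^k=I_t^k+a_t^k-\xi_t^k$ for $k\in[K]$ and $I_{t+1}^w=I_t^w+a_t^w-\sum_{k\in[K]}a_t^k$. Cost in period $t$: $$h^w\Big(I_t^w-\sum_{k\in[K]}a_t^k\Big)+\sum_{k\in[K]}\Big(p^k(\xi_t^k-I_t^k-a_t^k)^+ + h^k(I_t^k+a_t^k-\xi_t^k)^+\Big).$$ Policies choose $a_t$ based on information available before $\xi_t$ is realized. **GNN policies.** Let $\mathcal N=\{0\}\cup\mathcal N_+$ and let the directed edges be $\mathcal E=\{(0,w)\}\cup\{(w,k):k\in[K]\}$. For a node $k$ let $\mathcal N^k_{\rm sup}$ and $\mathcal N^k_{\rm rec}$ be the sets of its in-neighbours and out-neighbours. Each node $k$ has a feature vector $S_t^k$ containing its type (supplier, warehouse, store), its current inventory $I_t^k$ (for $k\in\mathcal N_+$) and its local parameters ($\underline u^k,\overline u^k,p^k,h^k$ for a store); each edge has its lead time $L^{(j,k)}$ as feature. An $R$-round GNN policy is a policy obtained as follows, for some functions EmbedNode, EmbedEdge, UpdateNode, UpdateEdge (with values in finite-dimensional Euclidean spaces) and Readout (real-valued),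 each one shared by all nodes or edges (the functions may be chosen depending on the problem instance): (i) $h^k\leftarrow \mathrm{EmbedNode}(S_t^k)$ for all nodes, $h^{(j,k)}\leftarrow\mathrm{EmbedEdge}(h^j,h^k,L^{(j,k)})$ for all edges (here $h$ with node or edge superscript denotes an embedding, not a cost). (ii) Repeat $R$ times: for each $k\in\mathcal N_+$ set $z^k_{\rm in}=\sum_{j\in\mathcal N^k_{\rm sup}}h^{(j,k)}/\sqrt{|\mathcal N^k_{\rm sup}|}$ and $z^k_{\rm out}=\sum_{j\in\mathcal N^k_{\rm rec}}h^{(k,j)}/\sqrt{|\mathcal N^k_{\rm rec}|}$ (an empty sum gives $0$), and $h^k\leftarrow h^k+\mathrm{UpdateNode}(h^k,z^k_{\rm in},z^k_{\rm out})$; then for every edge $h^{(j,k)}\leftarrow h^{(j,k)}+\mathrm{UpdateEdge}(h^{(j,k)},h^j,h^k)$. (iii) $b^{(j,k)}\leftarrow\mathrm{Readout}(h^{(j,k)})$ for each edge. (iv) The order on $(0,w)$ is $a_t^w=b^{(0,w)}$ (required nonnegative), and the shipments $(a_t^k)_{k\in[K]}$ are obtained by applying to $(I_t^w,(b^{(w,k)})_{k\in[K]})$ a fixed feasibility enforcement map whose output is a nonnegative vector with sum at most $I_t^w$, for instance Proportional Allocation $a_t^k=[b^{(w,k)}]^+\min\{1, I_t^w/\sum_{j\in[K]}[b^{(w,j)}]^+\}$ (with $a_t^k=0$ if $[b^{(w,k)}]^+=0$). *)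

theory Defs
  imports "HOL-Probability.Probability"
begin

datatype node = Supplier | Warehouse | Store nat

record inv_problem =
  num_stores :: nat
  horizon :: nat
  underage :: "nat \<Rightarrow> real"
  holding :: "nat \<Rightarrow> real"
  holding_w :: real
  u_lo :: "nat \<Rightarrow> real"
  u_hi :: "nat \<Rightarrow> real"
  prob_high :: real
  gamma_L :: real
  gamma_H :: real

abbreviation stores :: "inv_problem \<Rightarrow> nat set" where
  "stores P \<equiv> {1..num_stores P}"

abbreviation periods :: "inv_problem \<Rightarrow> nat set" where
  "periods P \<equiv> {1..horizon P}"

definition stock_nodes :: "inv_problem \<Rightarrow> node set" where
  "stock_nodes P = insert Warehouse (Store ` stores P)"

definition admissible ::
  "real \<Rightarrow> real \<Rightarrow> real \<Rightarrow> real \<Rightarrow> real \<Rightarrow> real \<Rightarrow> real \<Rightarrow> real \<Rightarrow> inv_problem \<Rightarrow> bool" where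
  "admissible p_lo p_hi h_lo h_hi q \<kappa> \<gamma>L \<gamma>H P \<longleftrightarrow>
     num_stores P \<ge> 1 \<and> horizon P \<ge> 1 \<and>
     prob_high P = q \<and> gamma_L P = \<gamma>L \<and> gamma_H P = \<gamma>H \<and>
     holding_w P \<ge> 0 \<and>
     (\<forall>k\<in>stores P.
        underage P k \<in> {p_lo..p_hi} \<and> holding P k \<in> {h_lo..h_hi} \<and>
        u_lo P k < u_hi P k \<and> u_hi P k \<in> {1 / \<kappa>..\<kappa>} \<and>
        \<gamma>L * u_lo P k \<ge> \<gamma>H * u_hi P k - \<gamma>L * u_lo P k) \<and>
     q * p_lo \<ge> (1 - q) * holding_w P"


section \<open>Demand\<close>

text \<open>One period draws \<open>(B, U)\<close>; a sample point \<open>\<omega>\<close> assigns such a pair to each period.\<close>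

definition period_law :: "inv_problem \<Rightarrow> (real \<times> (nat \<Rightarrow> real)) measure" where
  "period_law P =
     distr (measure_pmf (bernoulli_pmf (prob_high P))) borel
       (\<lambda>b. if b then gamma_H P else gamma_L P)
     \<Otimes>\<^sub>M PiM (stores P) (\<lambda>k. uniform_measure lborel {u_lo P k..u_hi P k})"

definition sample_law :: "inv_problem \<Rightarrow> (nat \<Rightarrow> real \<times> (nat \<Rightarrow> real)) measure" where
  "sample_law P = PiM (periods P) (\<lambda>_. period_law P)"

definition demand :: "(nat \<Rightarrow> real \<times> (nat \<Rightarrow> real)) \<Rightarrow> nat \<Rightarrow> nat \<Rightarrow> real" where
  "demand \<omega> t k = fst (\<omega> t) * snd (\<omega> t) k"


section \<open>Policies, dynamics and cost\<close>

text \<open>A policy maps the period and the demands observed in earlier periods to an action; past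
  inventories and actions are functions of these. An action gives the order at \<open>Warehouse\<close>
  and the shipments at the stores; its value at \<open>Supplier\<close> is irrelevant.\<close>

type_synonym action = "node \<Rightarrow> real"
type_synonym demand_path = "nat \<Rightarrow> nat \<Rightarrow> real"
type_synonym policy = "nat \<Rightarrow> demand_path \<Rightarrow> action"

definition history :: "inv_problem \<Rightarrow> nat \<Rightarrow> demand_path \<Rightarrow> demand_path" where
  "history P t d = (\<lambda>s\<in>{1..<t}. \<lambda>k\<in>stores P. d s k)"

definition history_space :: "inv_problem \<Rightarrow> nat \<Rightarrow> demand_path measure" where
  "history_space P t = PiM {1..<t} (\<lambda>_. PiM (stores P) (\<lambda>_. borel))"

definition next_inventory ::
  "inv_problem \<Rightarrow> (node \<Rightarrow> real) \<Rightarrow> action \<Rightarrow> (nat \<Rightarrow> real) \<Rightarrow> node \<Rightarrow> real" where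
  "next_inventory P I a x n = (case n of
      Supplier \<Rightarrow> 0
    | Warehouse \<Rightarrow> I Warehouse + a Warehouse - (\<Sum>k\<in>stores P. a (Store k))
    | Store k \<Rightarrow> I (Store k) + a (Store k) - x k)"

text \<open>Inventory at the start of a period under a policy and a demand path. The first period
  is \<open>1\<close>; the value at \<open>0\<close> is a dummy.\<close>

primrec inventory :: "inv_problem \<Rightarrow> policy \<Rightarrow> demand_path \<Rightarrow> nat \<Rightarrow> node \<Rightarrow> real" where
  "inventory P \<pi> d 0 = (\<lambda>_. 0)"
| "inventory P \<pi> d (Suc t) =
     (if t = 0 then (\<lambda>_. 0)
      else next_inventory P (inventory P \<pi> d t) (\<pi> t (history P t d)) (d t))"

definition period_cost ::
  "inv_problem \<Rightarrow> (node \<Rightarrow> real) \<Rightarrow> action \<Rightarrow> (nat \<Rightarrow> real) \<Rightarrow> real" where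
  "period_cost P I a x =
     holding_w P * (I Warehouse - (\<Sum>k\<in>stores P. a (Store k))) +
     (\<Sum>k\<in>stores P.
        underage P k * max 0 (x k - I (Store k) - a (Store k)) +
        holding P k * max 0 (I (Store k) + a (Store k) - x k))"

definition total_cost :: "inv_problem \<Rightarrow> policy \<Rightarrow> demand_path \<Rightarrow> real" where
  "total_cost P \<pi> d =
     (\<Sum>t\<in>periods P. period_cost P (inventory P \<pi> d t) (\<pi> t (history P t d)) (d t))"

definition feasible_action :: "inv_problem \<Rightarrow> (node \<Rightarrow> real) \<Rightarrow> action \<Rightarrow> bool" where
  "feasible_action P I a \<longleftrightarrow>
     (\<forall>n\<in>stock_nodes P. a n \<ge> 0) \<and> (\<Sum>k\<in>stores P. a (Store k)) \<le> I Warehouse"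

definition feasible_policy :: "inv_problem \<Rightarrow> policy \<Rightarrow> bool" where
  "feasible_policy P \<pi> \<longleftrightarrow>
     (\<forall>t\<in>periods P. \<forall>n\<in>stock_nodes P. (\<lambda>d. \<pi> t d n) \<in> borel_measurable (history_space P t)) \<and>
     (AE \<omega> in sample_law P. \<forall>t\<in>periods P.
        feasible_action P (inventory P \<pi> (demand \<omega>) t) (\<pi> t (history P t (demand \<omega>))))"

text \<open>Costs of feasible policies are nonnegative, but need not have finite expectation (orders
  are unbounded), so the expectation is taken in \<open>ennreal\<close>.\<close>

definition expected_cost :: "inv_problem \<Rightarrow> policy \<Rightarrow> ennreal" where
  "expected_cost P \<pi> = (\<integral>\<^sup>+ \<omega>. ennreal (total_cost P \<pi> (demand \<omega>)) \<partial>sample_law P)"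


section \<open>Message-passing policies\<close>

type_synonym edge = "node \<times> node"

definition edges :: "inv_problem \<Rightarrow> edge set" where
  "edges P = insert (Supplier, Warehouse) ((\<lambda>k. (Warehouse, Store k)) ` stores P)"

definition suppliers_of :: "inv_problem \<Rightarrow> node \<Rightarrow> node set" where
  "suppliers_of P k = {j. (j, k) \<in> edges P}"

definition receivers_of :: "inv_problem \<Rightarrow> node \<Rightarrow> node set" where
  "receivers_of P k = {j. (k, j) \<in> edges P}"

definition lead_time :: "edge \<Rightarrow> real" where
  "lead_time e = (if e = (Supplier, Warehouse) then 1 else 0)"

text \<open>The constructor is the type of the node. Arguments: inventory and holding cost; respectively
  inventory, the two demand bounds, underage cost and holding cost.\<close>

datatype feature =
    SupplierF
  | WarehouseF real real
  | StoreF real real real real real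

definition node_feature :: "inv_problem \<Rightarrow> (node \<Rightarrow> real) \<Rightarrow> node \<Rightarrow> feature" where
  "node_feature P I n = (case n of
      Supplier \<Rightarrow> SupplierF
    | Warehouse \<Rightarrow> WarehouseF (I Warehouse) (holding_w P)
    | Store k \<Rightarrow> StoreF (I (Store k)) (u_lo P k) (u_hi P k) (underage P k) (holding P k))"

text \<open>The dimension of an embedding space is existentially quantified in the end, so
  $\mathbb{R}^d$ is rendered as the sequences that vanish from index \<open>d\<close> on.\<close>

type_synonym vec = "nat \<Rightarrow> real"

definition euclid :: "nat \<Rightarrow> vec set" where
  "euclid d = {v. \<forall>i\<ge>d. v i = 0}"

record gnn =
  node_dim :: nat
  edge_dim :: nat
  embed_node :: "feature \<Rightarrow> vec"
  embed_edge :: "vec \<Rightarrow> vec \<Rightarrow> real \<Rightarrow> vec"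
  update_node :: "vec \<Rightarrow> vec \<Rightarrow> vec \<Rightarrow> vec"
  update_edge :: "vec \<Rightarrow> vec \<Rightarrow> vec \<Rightarrow> vec"
  readout :: "vec \<Rightarrow> real"

definition gnn_wf :: "gnn \<Rightarrow> bool" where
  "gnn_wf G \<longleftrightarrow>
     (\<forall>s. embed_node G s \<in> euclid (node_dim G)) \<and>
     (\<forall>x y l. embed_edge G x y l \<in> euclid (edge_dim G)) \<and>
     (\<forall>x y z. update_node G x y z \<in> euclid (node_dim G)) \<and>
     (\<forall>x y z. update_edge G x y z \<in> euclid (edge_dim G))"

type_synonym embedding = "(node \<Rightarrow> vec) \<times> (edge \<Rightarrow> vec)"

definition initial_embedding :: "inv_problem \<Rightarrow> gnn \<Rightarrow> (node \<Rightarrow> real) \<Rightarrow> embedding" where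
  "initial_embedding P G I =
     (let hn = (\<lambda>k. embed_node G (node_feature P I k))
      in (hn, \<lambda>(j, k). embed_edge G (hn j) (hn k) (lead_time (j, k))))"

definition z_in :: "inv_problem \<Rightarrow> (edge \<Rightarrow> vec) \<Rightarrow> node \<Rightarrow> vec" where
  "z_in P he k = (\<lambda>i. (\<Sum>j\<in>suppliers_of P k. he (j, k) i) / sqrt (card (suppliers_of P k)))"

definition z_out :: "inv_problem \<Rightarrow> (edge \<Rightarrow> vec) \<Rightarrow> node \<Rightarrow> vec" where
  "z_out P he k = (\<lambda>i. (\<Sum>j\<in>receivers_of P k. he (k, j) i) / sqrt (card (receivers_of P k)))"

definition message_round :: "inv_problem \<Rightarrow> gnn \<Rightarrow> embedding \<Rightarrow> embedding" where
  "message_round P G = (\<lambda>(hn, he).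
     let hn' = (\<lambda>k. if k \<in> stock_nodes P
                     then (\<lambda>i. hn k i + update_node G (hn k) (z_in P he k) (z_out P he k) i)
                     else hn k)
     in (hn', \<lambda>(j, k) i. he (j, k) i + update_edge G (he (j, k)) (hn' j) (hn' k) i))"

definition gnn_output :: "inv_problem \<Rightarrow> gnn \<Rightarrow> nat \<Rightarrow> (node \<Rightarrow> real) \<Rightarrow> edge \<Rightarrow> real" where
  "gnn_output P G R I e =
     readout G (snd ((message_round P G ^^ R) (initial_embedding P G I)) e)"

definition proportional_allocation ::
  "inv_problem \<Rightarrow> real \<Rightarrow> (nat \<Rightarrow> real) \<Rightarrow> nat \<Rightarrow> real" where
  "proportional_allocation P x b k =
     (if max 0 (b k) = 0 then 0
      else max 0 (b k) * min 1 (x / (\<Sum>j\<in>stores P. max 0 (b j))))"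

definition gnn_action :: "inv_problem \<Rightarrow> gnn \<Rightarrow> nat \<Rightarrow> (node \<Rightarrow> real) \<Rightarrow> action" where
  "gnn_action P G R I n = (case n of
      Supplier \<Rightarrow> 0
    | Warehouse \<Rightarrow> gnn_output P G R I (Supplier, Warehouse)
    | Store k \<Rightarrow> proportional_allocation P (I Warehouse)
                  (\<lambda>j. gnn_output P G R I (Warehouse, Store j)) k)"

definition gnn_policy :: "inv_problem \<Rightarrow> nat \<Rightarrow> policy \<Rightarrow> bool" where
  "gnn_policy P R \<pi> \<longleftrightarrow>
     (\<exists>G. gnn_wf G \<and>
        (\<forall>t\<in>periods P. \<forall>d. \<forall>n\<in>stock_nodes P.
           \<pi> t (history P t d) n = gnn_action P G R (inventory P \<pi> d t) n))"

end

theory Submission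
  imports Defs "HOL-Combinatorics.Permutations"
begin

text \<open>
  The functions of a message-passing policy are unrestricted, so one round already suffices for a
  policy whose cost exceeds the infimum by an arbitrarily small amount; the constant is \<open>C = 1\<close>.
  By backward induction the optimal cost-to-go is Lipschitz in the \<open>\<ell>\<^sup>1\<close> distance, convex, and invariant
  under permutations of stores with equal parameters. Hence there are nearly optimal actions that
  treat stores with equal parameters and equal (rounded) inventories alike. The warehouse keeps its
  inventory on a lattice \<open>\<eta>\<nat>\<close> and encodes the current period in the residue of the lattice index
  modulo the horizon, at the price of an order that is too large by at most \<open>\<eta>\<close> times the horizon.
  A store sends \<open>(K+1)\<close> to the power of the class of its parameters and rounded inventory; the sum of these
  numbers determines how many stores are in each class, so that the warehouse knows the whole
  state up to rounding and a permutation of equal stores.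
\<close>

text \<open>The same functions act in all periods and no feature carries the period, whereas good
  actions depend on the number of remaining periods; hence the clock. It can live in the warehouse
  because no demand hits that stock: order and shipments determine its next value, so the order can
  steer it to any sufficiently high lattice point. Edges to stores with equal features necessarily
  get equal outputs; hence the need for symmetric actions, which convexity provides by averaging.
  The Lipschitz bound serves twice: it pays for rounding, and it makes the cost-to-go measurable
  although it is an infimum over uncountably many actions. The policy reads a countable table, so no
  measurable selection is made, and the cost-to-go only has to bound the cost of feasible policies
  from below, without being attained. It is positive, because the warehouse is empty in period 1 and
  the demand of that period is backlogged; so when it is finite, a small absolute error is a small
  relative error, and its value divided by the square root of the number of stores is the error
  aimed at.\<close>

instance node :: countable
  by countable_datatype

section \<open>Preliminaries\<close>

text \<open>Resampling coordinate \<open>i\<close> independently does not change the law. This will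
  integrate out the demand of the current period while the past stays fixed.\<close>

lemma (in product_prob_space) nn_integral_PiM_update:
  assumes "finite I" "i \<in> I" "f \<in> borel_measurable (PiM I M)"
  shows "(\<integral>\<^sup>+w. f w \<partial>PiM I M) = (\<integral>\<^sup>+w. (\<integral>\<^sup>+z. f (w(i := z)) \<partial>M i) \<partial>PiM I M)"
proof -
  let ?J = "I - {i}"
  have I: "I = insert i ?J" "finite ?J" "i \<notin> ?J"
    using assms by auto
  have upd: "(\<lambda>(w, z). f (w(i := z))) \<in> borel_measurable (PiM I M \<Otimes>\<^sub>M M i)"
  proof -
    have "(\<lambda>(w, z). (w(i := z))) \<in> measurable (PiM I M \<Otimes>\<^sub>M M i) (PiM (insert i I) M)"
      by (rule measurable_add_dim)
    then show ?thesis
      using assms(2,3) by (auto simp: insert_absorb split_beta' intro: measurable_compose)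
  qed
  have g: "(\<lambda>w. \<integral>\<^sup>+z. f (w(i := z)) \<partial>M i) \<in> borel_measurable (PiM I M)"
    using M.borel_measurable_nn_integral_fst[OF upd] by simp
  have "(\<integral>\<^sup>+w. f w \<partial>PiM I M) = (\<integral>\<^sup>+w. (\<integral>\<^sup>+y. f (w(i := y)) \<partial>M i) \<partial>PiM ?J M)"
    using product_nn_integral_insert[OF I(2,3), of f] assms(3) I(1) by simp
  \<comment> \<open>\<open>z\<close> overwrites \<open>y\<close>, so the integral over
    \<open>y\<close> only contributes the total mass 1.\<close>
  also have "\<dots> = (\<integral>\<^sup>+w. (\<integral>\<^sup>+y. (\<integral>\<^sup>+z. f (w(i := y, i := z)) \<partial>M i) \<partial>M i) \<partial>PiM ?J M)"
    by (simp add: M.emeasure_space_1)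
  also have "\<dots> = (\<integral>\<^sup>+w. (\<integral>\<^sup>+z. f (w(i := z)) \<partial>M i) \<partial>PiM I M)"
    using product_nn_integral_insert[OF I(2,3), of "\<lambda>w. \<integral>\<^sup>+z. f (w(i := z)) \<partial>M i"] g I(1) by simp
  finally show ?thesis .
qed

lemma continuous_on_of_l1_bound:
  fixes v :: "('i \<Rightarrow> real) \<Rightarrow> real"
  assumes lip: "\<And>x y. v x \<le> v y + L * (\<Sum>n\<in>S. \<bar>x n - y n\<bar>)"
  shows "continuous_on UNIV v"
  unfolding continuous_on_def
proof
  fix y
  let ?D = "\<lambda>x. L * (\<Sum>n\<in>S. \<bar>x n - y n\<bar>)"
  have "continuous_on UNIV ?D"
    by (intro continuous_intros continuous_on_product_coordinates)
  then have lim: "(?D \<longlongrightarrow> 0) (at y)"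
    by (auto simp: continuous_on_def dest: spec[of _ y])
  have "dist (v x) (v y) \<le> ?D x" for x
    using lip[of x y] lip[of y x] by (auto simp: dist_real_def abs_minus_commute)
  then have "((\<lambda>x. dist (v x) (v y)) \<longlongrightarrow> 0) (at y)"
    using lim by (intro tendsto_sandwich[OF _ _ tendsto_const lim]) auto
  then show "(v \<longlongrightarrow> v y) (at y)"
    by (subst tendsto_dist_iff)
qed

text \<open>One infinite value forces the value infinity everywhere, so \<open>F\<close> is either
  constant or a real-valued Lipschitz function, which is continuous in the product topology.\<close>

lemma borel_measurable_of_l1_bound:
  fixes F :: "('i::countable \<Rightarrow> real) \<Rightarrow> ennreal"
  assumes S: "finite S"
    and lip: "\<And>x y. F x \<le> F y + ennreal (L * (\<Sum>n\<in>S. \<bar>x n - y n\<bar>))"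
    and X: "\<And>n. n \<in> S \<Longrightarrow> (\<lambda>\<omega>. X \<omega> n) \<in> borel_measurable M"
  shows "(\<lambda>\<omega>. F (X \<omega>)) \<in> borel_measurable M"
proof (cases "\<exists>x. F x = \<top>")
  case True
  then obtain x where "F x = \<top>" ..
  then have "F y = \<top>" for y
    using lip[of x y] by (auto simp: top_unique ennreal_add_eq_top)
  then show ?thesis
    by simp
next
  case False
  define v where "v x = enn2real (F x)" for x
  have F: "F x = ennreal (v x)" for x
    using False by (simp add: v_def less_top[symmetric])
  \<comment> \<open>\<open>X\<close> is measurable on \<open>S\<close> only; \<open>F\<close> does
    not see the other coordinates, so they are set to 0.\<close>
  define Y where "Y \<omega> n = (if n \<in> S then X \<omega> n else 0)" for \<omega> n
  have "v x \<le> v y + \<bar>L\<bar> * (\<Sum>n\<in>S. \<bar>x n - y n\<bar>)" for x y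
  proof -
    have "ennreal (v x) \<le> ennreal (v y) + ennreal (\<bar>L\<bar> * (\<Sum>n\<in>S. \<bar>x n - y n\<bar>))"
      using lip[of x y] unfolding F
      by (rule order_trans) (intro add_left_mono ennreal_leI mult_right_mono, auto intro: sum_nonneg)
    then show ?thesis
      by (simp add: v_def sum_nonneg flip: ennreal_plus)
  qed
  then have "continuous_on UNIV v"
    by (rule continuous_on_of_l1_bound)
  then have v: "v \<in> borel_measurable borel"
    by (rule borel_measurable_continuous_onI)
  \<comment> \<open>For a countable index type, coordinatewise measurability is measurability into
    the Borel sets of the function space.\<close>
  have "Y \<in> borel_measurable M"
  proof (rule measurable_coordinatewise_then_product)
    show "(\<lambda>\<omega>. Y \<omega> n) \<in> borel_measurable M" for n
      using X by (cases "n \<in> S") (simp_all add: Y_def)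
  qed
  then have "(\<lambda>\<omega>. ennreal (v (Y \<omega>))) \<in> borel_measurable M"
    using v by measurable
  moreover have "F (X \<omega>) = F (Y \<omega>)" for \<omega>
    using lip[of "X \<omega>" "Y \<omega>"] lip[of "Y \<omega>" "X \<omega>"] by (simp add: Y_def)
  ultimately show ?thesis
    by (simp add: F)
qed

lemma INF_ennreal_near:
  fixes f :: "'a \<Rightarrow> ennreal"
  assumes "A \<noteq> {}" "0 < e"
  shows "\<exists>a\<in>A. f a \<le> (INF a\<in>A. f a) + ennreal e"
proof (cases "(INF a\<in>A. f a) = \<top>")
  case True
  then show ?thesis
    using assms by auto
next
  case False
  then show ?thesis
    using INF_approx_ennreal[OF assms(2) refl, of f A] by (auto intro: less_imp_le)
qed

lemma le_INF_add_ennreal: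
  fixes f :: "'a \<Rightarrow> ennreal"
  assumes "\<And>a. a \<in> A \<Longrightarrow> x \<le> f a + ennreal c"
  shows "x \<le> (INF a\<in>A. f a) + ennreal c"
proof -
  have "x - ennreal c \<le> (INF a\<in>A. f a)"
    using assms by (intro INF_greatest) (simp add: ennreal_minus_le_iff add.commute)
  then show ?thesis
    by (simp add: ennreal_minus_le_iff add.commute)
qed

section \<open>Recovering a multiset of codes from a single sum\<close>

lemma digits_unique:
  fixes b :: nat
  assumes "\<And>i. f i < b" "\<And>i. g i < b"
    and "(\<Sum>i<n. f i * b ^ i) = (\<Sum>i<n. g i * b ^ i)"
  shows "\<forall>i<n. f i = g i"
  using assms
proof (induction n arbitrary: f g)
  case (Suc n)
  have split: "(\<Sum>i<Suc n. h i * b ^ i) = h 0 + b * (\<Sum>i<n. h (Suc i) * b ^ i)" for h :: "nat \<Rightarrow> nat"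
    by (subst sum.lessThan_Suc_shift) (simp add: sum_distrib_left ac_simps)
  have eq: "f 0 + b * (\<Sum>i<n. f (Suc i) * b ^ i) = g 0 + b * (\<Sum>i<n. g (Suc i) * b ^ i)"
    using Suc.prems(3) unfolding split .
  have "f 0 = g 0"
    using arg_cong[OF eq, of "\<lambda>x. x mod b"] Suc.prems(1,2)[of 0] by simp
  moreover have "0 < b"
    using Suc.prems(1)[of 0] by simp
  ultimately have "(\<Sum>i<n. f (Suc i) * b ^ i) = (\<Sum>i<n. g (Suc i) * b ^ i)"
    using eq by simp
  then have "\<forall>i<n. f (Suc i) = g (Suc i)"
    using Suc.prems(1,2) by (intro Suc.IH) auto
  with \<open>f 0 = g 0\<close> show ?case
    by (auto simp: less_Suc_eq_0_disj)
qed simp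

text \<open>Grouped by exponent, the sum has as its digit at place \<open>i\<close> the number of
  elements with value \<open>i\<close>; \<open>card A < b\<close> rules out carries. Equal digits
  mean equal multisets of values, which a permutation of \<open>A\<close> matches up.\<close>

lemma sum_power_eq_imp_permutes:
  fixes f g :: "'a \<Rightarrow> nat" and b :: nat
  assumes A: "finite A" "card A < b"
    and eq: "(\<Sum>k\<in>A. b ^ f k) = (\<Sum>k\<in>A. b ^ g k)"
  obtains p where "p permutes A" "\<forall>k\<in>A. f k = g (p k)"
proof -
  \<comment> \<open>A common number of digits for both sums; \<open>insert 0\<close> serves the
    empty set.\<close>
  define n where "n = Suc (Max (insert 0 (f ` A \<union> g ` A)))"
  have n: "f k < n" "g k < n" if "k \<in> A" for k
    using that A(1) by (auto simp: n_def less_Suc_eq_le intro!: Max_ge)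
  have count: "count (image_mset h (mset_set A)) i = card {k\<in>A. h k = i}" for h :: "'a \<Rightarrow> nat" and i
    using A(1) by (simp add: count_image_mset vimage_def Int_def conj_commute)
  have digits: "(\<Sum>k\<in>A. b ^ h k) = (\<Sum>i<n. card {k\<in>A. h k = i} * b ^ i)"
    if "\<And>k. k \<in> A \<Longrightarrow> h k < n" for h
  proof -
    have "(\<Sum>k\<in>A. b ^ h k) = (\<Sum>i<n. \<Sum>k\<in>{k\<in>A. h k = i}. b ^ h k)"
      using that A(1) by (intro sum.group[symmetric]) auto
    then show ?thesis
      by simp
  qed
  have lt: "card {k\<in>A. h k = i} < b" for h :: "'a \<Rightarrow> nat" and i
    using card_mono[OF A(1), of "{k\<in>A. h k = i}"] A(2) by force
  have "(\<Sum>i<n. card {k\<in>A. f k = i} * b ^ i) = (\<Sum>i<n. card {k\<in>A. g k = i} * b ^ i)"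
    using digits[of f, OF n(1)] digits[of g, OF n(2)] eq by metis
  then have "\<forall>i<n. card {k\<in>A. f k = i} = card {k\<in>A. g k = i}"
    by (rule digits_unique[OF lt lt])
  moreover have "card {k\<in>A. f k = i} = card {k\<in>A. g k = i}" if "\<not> i < n" for i
  proof -
    have "{k\<in>A. f k = i} = {}" "{k\<in>A. g k = i} = {}"
      using that by (auto dest: n)
    then show ?thesis
      by (simp only:)
  qed
  ultimately have "card {k\<in>A. f k = i} = card {k\<in>A. g k = i}" for i
    by blast
  then have "image_mset f (mset_set A) = image_mset g (mset_set A)"
    by (intro multiset_eqI) (simp only: count)
  then show thesis
    using that image_mset_eq_implies_permutes[OF A(1)] by metis
qed

section \<open>The cost-to-go\<close>

lemma ennreal_add_le: "ennreal (a + b) \<le> ennreal a + ennreal b"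
proof -
  have "ennreal (a + b) \<le> ennreal (max 0 a + max 0 b)"
    by (intro ennreal_leI) auto
  also have "\<dots> = ennreal a + ennreal b"
    by (subst ennreal_plus) (auto simp: max_def ennreal_neg)
  finally show ?thesis .
qed

lemma sum_stock_nodes:
  "(\<Sum>n\<in>stock_nodes P. f n) = f Warehouse + (\<Sum>k\<in>stores P. f (Store k))"
proof -
  have "(\<Sum>n\<in>Store ` stores P. f n) = (\<Sum>k\<in>stores P. f (Store k))"
    by (subst sum.reindex) (auto simp: inj_on_def)
  then show ?thesis
    unfolding stock_nodes_def by (subst sum.insert) auto
qed

lemma finite_stock_nodes [simp]: "finite (stock_nodes P)"
  by (simp add: stock_nodes_def)

lemma Warehouse_in_stock_nodes [simp]: "Warehouse \<in> stock_nodes P"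
  and Store_in_stock_nodes [simp]: "Store k \<in> stock_nodes P \<longleftrightarrow> k \<in> stores P"
  and Supplier_notin_stock_nodes [simp]: "Supplier \<notin> stock_nodes P"
  by (auto simp: stock_nodes_def)

text \<open>Demand in terms of the sample point of a single period, so that it can be integrated
  against \<open>period_law\<close>.\<close>

definition draw :: "real \<times> (nat \<Rightarrow> real) \<Rightarrow> nat \<Rightarrow> real" where
  "draw z k = fst z * snd z k"

definition perm_state :: "(nat \<Rightarrow> nat) \<Rightarrow> (node \<Rightarrow> real) \<Rightarrow> node \<Rightarrow> real" where
  "perm_state s x n = (case n of Store k \<Rightarrow> x (Store (s k)) | _ \<Rightarrow> x n)"

lemma perm_state_simps [simp]:
  "perm_state s x Supplier = x Supplier"
  "perm_state s x Warehouse = x Warehouse"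
  "perm_state s x (Store k) = x (Store (s k))"
  by (simp_all add: perm_state_def)

lemma next_inventory_simps [simp]:
  "next_inventory P x a d Supplier = 0"
  "next_inventory P x a d Warehouse = x Warehouse + a Warehouse - (\<Sum>k\<in>stores P. a (Store k))"
  "next_inventory P x a d (Store k) = x (Store k) + a (Store k) - d k"
  by (simp_all add: next_inventory_def)

locale inventory_problem =
  fixes P :: inv_problem
  assumes num_stores_pos: "1 \<le> num_stores P"
    and horizon_pos: "1 \<le> horizon P"
    and u_less: "k \<in> stores P \<Longrightarrow> u_lo P k < u_hi P k"
    and u_lo_pos: "k \<in> stores P \<Longrightarrow> 0 < u_lo P k"
    and underage_pos: "k \<in> stores P \<Longrightarrow> 0 < underage P k"
    and holding_nonneg: "k \<in> stores P \<Longrightarrow> 0 \<le> holding P k"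
    and holding_w_nonneg: "0 \<le> holding_w P"
    and gamma_L_pos: "0 < gamma_L P"
    and gamma_L_le_H: "gamma_L P \<le> gamma_H P"
begin

lemma prob_space_U: "k \<in> stores P \<Longrightarrow> prob_space (uniform_measure lborel {u_lo P k..u_hi P k})"
  using u_less[of k] by (intro prob_space_uniform_measure) auto

lemma prob_space_U_PiM:
  "prob_space (PiM (stores P) (\<lambda>k. uniform_measure lborel {u_lo P k..u_hi P k}))"
  by (intro prob_space_PiM prob_space_U)

lemma prob_space_B:
  "prob_space (distr (measure_pmf (bernoulli_pmf (prob_high P))) borel
     (\<lambda>b. if b then gamma_H P else gamma_L P))"
  by (intro prob_space.prob_space_distr prob_space_measure_pmf) auto

lemma prob_space_period_law: "prob_space (period_law P)"
  unfolding period_law_def by (intro prob_space_pair prob_space_B prob_space_U_PiM)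

sublocale period: prob_space "period_law P"
  by (rule prob_space_period_law)

lemma measurable_draw: "k \<in> stores P \<Longrightarrow> (\<lambda>z. draw z k) \<in> borel_measurable (period_law P)"
proof -
  assume k: "k \<in> stores P"
  have "(\<lambda>w. w k) \<in> measurable (PiM (stores P) (\<lambda>k. uniform_measure lborel {u_lo P k..u_hi P k}))
      (uniform_measure lborel {u_lo P k..u_hi P k})"
    using k by (rule measurable_component_singleton)
  then have "(\<lambda>w. w k) \<in> borel_measurable (PiM (stores P) (\<lambda>k. uniform_measure lborel {u_lo P k..u_hi P k}))"
    by (simp add: measurable_def space_uniform_measure sets_uniform_measure cong: measurable_cong_sets)
  then have "(\<lambda>z. snd z k) \<in> borel_measurable (period_law P)"
    unfolding period_law_def by (rule measurable_compose[OF measurable_snd])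
  moreover have "fst \<in> borel_measurable (period_law P)"
    unfolding period_law_def by (rule measurable_compose[OF measurable_fst]) simp
  ultimately show ?thesis
    unfolding draw_def by (intro borel_measurable_times) simp_all
qed

text \<open>The \<open>Supplier\<close> coordinate is a dummy and is left out. States that agree on
  \<open>stock_nodes P\<close> have distance 0, which later turns Lipschitz bounds into congruence
  rules.\<close>

definition dist1 :: "(node \<Rightarrow> real) \<Rightarrow> (node \<Rightarrow> real) \<Rightarrow> real" where
  "dist1 x y = (\<Sum>n\<in>stock_nodes P. \<bar>x n - y n\<bar>)"

lemma dist1_nonneg [simp]: "0 \<le> dist1 x y"
  by (simp add: dist1_def sum_nonneg)

lemma dist1_commute: "dist1 x y = dist1 y x"
  by (simp add: dist1_def abs_minus_commute)

lemma dist1_eq: "dist1 x y = \<bar>x Warehouse - y Warehouse\<bar> + (\<Sum>k\<in>stores P. \<bar>x (Store k) - y (Store k)\<bar>)"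
  by (simp add: dist1_def sum_stock_nodes)

text \<open>The truncation at \<open>0\<close> keeps this set nonempty for negative warehouse inventories, which makes
  the cost-to-go Lipschitz, and hence measurable, on all states.\<close>

definition actions :: "(node \<Rightarrow> real) \<Rightarrow> action set" where
  "actions x = {a. (\<forall>n\<in>stock_nodes P. 0 \<le> a n) \<and>
     (\<Sum>k\<in>stores P. a (Store k)) \<le> max 0 (x Warehouse)}"

lemma zero_in_actions: "(\<lambda>_. 0) \<in> actions x"
  by (simp add: actions_def)

lemma feasible_action_imp_actions: "feasible_action P x a \<Longrightarrow> a \<in> actions x"
  by (auto simp: feasible_action_def actions_def)

lemma actions_imp_feasible_action: "a \<in> actions x \<Longrightarrow> 0 \<le> x Warehouse \<Longrightarrow> feasible_action P x a"
  by (auto simp: feasible_action_def actions_def)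

text \<open>The first argument is the number of remaining periods.\<close>

primrec cost_to_go :: "nat \<Rightarrow> (node \<Rightarrow> real) \<Rightarrow> ennreal" where
  "cost_to_go 0 = (\<lambda>_. 0)"
| "cost_to_go (Suc r) = (\<lambda>x. INF a\<in>actions x.
     \<integral>\<^sup>+z. ennreal (period_cost P x a (draw z)) + cost_to_go r (next_inventory P x a (draw z)) \<partial>period_law P)"

definition action_cost :: "nat \<Rightarrow> (node \<Rightarrow> real) \<Rightarrow> action \<Rightarrow> ennreal" where
  "action_cost r x a =
     (\<integral>\<^sup>+z. ennreal (period_cost P x a (draw z)) + cost_to_go r (next_inventory P x a (draw z)) \<partial>period_law P)"

lemma cost_to_go_Suc: "cost_to_go (Suc r) x = (INF a\<in>actions x. action_cost r x a)"
  by (simp add: action_cost_def)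

declare cost_to_go.simps(2) [simp del]

subsection \<open>Lipschitz continuity of the cost-to-go\<close>

text \<open>A shipment acts twice, as it leaves the warehouse and reaches a store; hence the factor
  2.\<close>

lemma dist1_next_inventory:
  "dist1 (next_inventory P x a d) (next_inventory P y b d) \<le> 2 * (dist1 x y + dist1 a b)"
proof -
  let ?S = "stores P"
  have 1: "\<bar>(\<Sum>k\<in>?S. a (Store k)) - (\<Sum>k\<in>?S. b (Store k))\<bar> \<le> (\<Sum>k\<in>?S. \<bar>a (Store k) - b (Store k)\<bar>)"
    unfolding sum_subtractf[symmetric] by (rule sum_abs)
  have 2: "(\<Sum>k\<in>?S. \<bar>x (Store k) + a (Store k) - d k - (y (Store k) + b (Store k) - d k)\<bar>)
      \<le> (\<Sum>k\<in>?S. \<bar>x (Store k) - y (Store k)\<bar>) + (\<Sum>k\<in>?S. \<bar>a (Store k) - b (Store k)\<bar>)"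
    unfolding sum.distrib[symmetric] by (intro sum_mono) linarith
  have "0 \<le> (\<Sum>k\<in>?S. \<bar>x (Store k) - y (Store k)\<bar>)"
    "0 \<le> (\<Sum>k\<in>?S. \<bar>a (Store k) - b (Store k)\<bar>)"
    by (simp_all add: sum_nonneg)
  moreover have "\<bar>x1 + a1 - A - (y1 + b1 - B)\<bar> + T \<le> 2 * (\<bar>x1 - y1\<bar> + X + (\<bar>a1 - b1\<bar> + Y))"
    if "\<bar>A - B\<bar> \<le> Y" "T \<le> X + Y" "0 \<le> X" "0 \<le> Y" for x1 y1 a1 b1 A B T X Y :: real
  proof -
    have "\<bar>x1 + a1 - A - (y1 + b1 - B)\<bar> \<le> \<bar>x1 - y1\<bar> + \<bar>a1 - b1\<bar> + \<bar>A - B\<bar>"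
      by linarith
    then show ?thesis
      using that abs_ge_zero[of "x1 - y1"] abs_ge_zero[of "a1 - b1"]
      unfolding distrib_left by linarith
  qed
  ultimately show ?thesis
    unfolding dist1_eq next_inventory_simps using 1 2 by blast
qed

definition cost_rate :: real where
  "cost_rate = holding_w P + (\<Sum>k\<in>stores P. underage P k + holding P k)"

lemma cost_rate_nonneg: "0 \<le> cost_rate"
  unfolding cost_rate_def using holding_w_nonneg underage_pos holding_nonneg
  by (intro add_nonneg_nonneg sum_nonneg) (auto intro: less_imp_le)

text \<open>Each term changes by at most its cost rate times the distance. The factor 2 makes the
  bound add up with that of \<open>dist1_next_inventory\<close>.\<close>

lemma period_cost_lipschitz:
  "period_cost P x a d \<le> period_cost P y b d + 2 * cost_rate * (dist1 x y + dist1 a b)"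
proof -
  let ?S = "stores P"
  let ?D = "dist1 x y + dist1 a b"
  let ?g = "\<lambda>x a k. underage P k * max 0 (d k - x (Store k) - a (Store k)) +
        holding P k * max 0 (x (Store k) + a (Store k) - d k)"
  have sx: "(\<Sum>k\<in>?S. \<bar>x (Store k) - y (Store k)\<bar>) \<le> dist1 x y"
    and sa: "(\<Sum>k\<in>?S. \<bar>a (Store k) - b (Store k)\<bar>) \<le> dist1 a b"
    by (simp_all add: dist1_eq)
  have w: "holding_w P * (x Warehouse - (\<Sum>k\<in>?S. a (Store k)))
      \<le> holding_w P * (y Warehouse - (\<Sum>k\<in>?S. b (Store k))) + holding_w P * ?D"
  proof -
    have "\<bar>(\<Sum>k\<in>?S. a (Store k)) - (\<Sum>k\<in>?S. b (Store k))\<bar> \<le> (\<Sum>k\<in>?S. \<bar>a (Store k) - b (Store k)\<bar>)"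
      unfolding sum_subtractf[symmetric] by (rule sum_abs)
    moreover have "\<bar>x Warehouse - y Warehouse\<bar> \<le> dist1 x y"
      by (simp add: dist1_eq sum_nonneg)
    ultimately have "x Warehouse - (\<Sum>k\<in>?S. a (Store k)) \<le> y Warehouse - (\<Sum>k\<in>?S. b (Store k)) + ?D"
      using sa by linarith
    then show ?thesis
      using holding_w_nonneg by (metis distrib_left mult_left_mono)
  qed
  have k: "?g x a k \<le> ?g y b k + (underage P k + holding P k) * ?D" if k: "k \<in> ?S" for k
  proof -
    have "\<bar>x (Store k) - y (Store k)\<bar> \<le> (\<Sum>k\<in>?S. \<bar>x (Store k) - y (Store k)\<bar>)"
      "\<bar>a (Store k) - b (Store k)\<bar> \<le> (\<Sum>k\<in>?S. \<bar>a (Store k) - b (Store k)\<bar>)"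
      using k by (intro member_le_sum[where f = "\<lambda>k. \<bar>x (Store k) - y (Store k)\<bar>"]
        member_le_sum[where f = "\<lambda>k. \<bar>a (Store k) - b (Store k)\<bar>"]; simp)+
    then have "\<bar>x (Store k) - y (Store k)\<bar> + \<bar>a (Store k) - b (Store k)\<bar> \<le> ?D"
      using sx sa by linarith
    then have "max 0 (d k - x (Store k) - a (Store k)) \<le> max 0 (d k - y (Store k) - b (Store k)) + ?D"
      "max 0 (x (Store k) + a (Store k) - d k) \<le> max 0 (y (Store k) + b (Store k) - d k) + ?D"
      by linarith+
    then have "underage P k * max 0 (d k - x (Store k) - a (Store k))
        \<le> underage P k * (max 0 (d k - y (Store k) - b (Store k)) + ?D)"
      "holding P k * max 0 (x (Store k) + a (Store k) - d k)
        \<le> holding P k * (max 0 (y (Store k) + b (Store k) - d k) + ?D)"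
      using k underage_pos[of k] holding_nonneg[of k] by (auto intro!: mult_left_mono)
    then show ?thesis
      by (simp add: algebra_simps)
  qed
  have "(\<Sum>k\<in>?S. ?g x a k) \<le> (\<Sum>k\<in>?S. ?g y b k + (underage P k + holding P k) * ?D)"
    by (intro sum_mono k)
  also have "\<dots> = (\<Sum>k\<in>?S. ?g y b k) + (\<Sum>k\<in>?S. underage P k + holding P k) * ?D"
    by (subst sum.distrib) (simp only: sum_distrib_right)
  finally have "period_cost P x a d \<le> period_cost P y b d + cost_rate * ?D"
    using w by (simp add: period_cost_def cost_rate_def algebra_simps)
  also have "cost_rate * ?D \<le> 2 * cost_rate * ?D"
    using cost_rate_nonneg by (simp add: mult_right_mono)
  finally show ?thesis
    by simp
qed

lemma period_cost_nonneg: "feasible_action P x a \<Longrightarrow> 0 \<le> period_cost P x a d"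
  unfolding period_cost_def feasible_action_def
  using holding_w_nonneg underage_pos holding_nonneg
  by (intro add_nonneg_nonneg mult_nonneg_nonneg sum_nonneg) (auto intro: less_imp_le)

text \<open>The inductive step for \<open>cost_to_go_lipschitz\<close>, hence the bound on
  \<open>cost_to_go r\<close> as an assumption. That bound also supplies the measurability needed to
  split the integral.\<close>

lemma action_cost_lipschitz_aux:
  assumes L: "0 \<le> L" "\<And>x y. cost_to_go r x \<le> cost_to_go r y + ennreal (L * dist1 x y)"
  shows "action_cost r x a \<le> action_cost r y b + ennreal (2 * (cost_rate + L) * (dist1 x y + dist1 a b))"
proof -
  let ?D = "dist1 x y + dist1 a b"
  have meas: "(\<lambda>z. cost_to_go r (next_inventory P y b (draw z))) \<in> borel_measurable (period_law P)"
  proof (rule borel_measurable_of_l1_bound[where S = "stock_nodes P" and L = L])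
    fix n assume "n \<in> stock_nodes P"
    then show "(\<lambda>z. next_inventory P y b (draw z) n) \<in> borel_measurable (period_law P)"
      by (cases n) (auto intro!: borel_measurable_diff measurable_draw)
  qed (use L(2) in \<open>simp_all add: dist1_def\<close>)
  have meas': "(\<lambda>z. period_cost P y b (draw z)) \<in> borel_measurable (period_law P)"
    unfolding period_cost_def
    by (intro borel_measurable_add borel_measurable_sum borel_measurable_times borel_measurable_max
        borel_measurable_diff measurable_draw) auto
  have "action_cost r x a \<le> (\<integral>\<^sup>+z. (ennreal (period_cost P y b (draw z)) +
      cost_to_go r (next_inventory P y b (draw z))) + ennreal (2 * (cost_rate + L) * ?D) \<partial>period_law P)"
    unfolding action_cost_def
  proof (rule nn_integral_mono)
    fix z
    have "ennreal (period_cost P x a (draw z)) \<le> ennreal (period_cost P y b (draw z)) + ennreal (2 * cost_rate * ?D)"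
      using period_cost_lipschitz[of x a "draw z" y b] cost_rate_nonneg
      by (meson ennreal_leI ennreal_add_le order_trans)
    moreover have "cost_to_go r (next_inventory P x a (draw z))
        \<le> cost_to_go r (next_inventory P y b (draw z)) + ennreal (2 * L * ?D)"
      using dist1_next_inventory[of x a "draw z" y b] L
      by (intro order_trans[OF L(2)[of _ "next_inventory P y b (draw z)"]] add_left_mono ennreal_leI)
        (metis mult.assoc mult.commute mult_left_mono)
    ultimately have "ennreal (period_cost P x a (draw z)) + cost_to_go r (next_inventory P x a (draw z))
        \<le> (ennreal (period_cost P y b (draw z)) + ennreal (2 * cost_rate * ?D)) +
          (cost_to_go r (next_inventory P y b (draw z)) + ennreal (2 * L * ?D))"
      by (rule add_mono)
    also have "\<dots> = (ennreal (period_cost P y b (draw z)) + cost_to_go r (next_inventory P y b (draw z))) +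
        (ennreal (2 * cost_rate * ?D) + ennreal (2 * L * ?D))"
      by (simp add: ac_simps)
    also have "ennreal (2 * cost_rate * ?D) + ennreal (2 * L * ?D) = ennreal (2 * (cost_rate + L) * ?D)"
      using cost_rate_nonneg L(1) by (subst ennreal_plus[symmetric]) (auto simp: algebra_simps)
    finally show "ennreal (period_cost P x a (draw z)) + cost_to_go r (next_inventory P x a (draw z))
        \<le> ennreal (period_cost P y b (draw z)) + cost_to_go r (next_inventory P y b (draw z)) +
          ennreal (2 * (cost_rate + L) * ?D)" .
  qed
  also have "\<dots> = action_cost r y b + ennreal (2 * (cost_rate + L) * ?D)"
    unfolding action_cost_def using meas meas'
    by (subst nn_integral_add) (auto simp: period.emeasure_space_1)
  finally show ?thesis .
qed

text \<open>When less warehouse stock is available, the shipments are scaled down proportionally.\<close>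

lemma nearby_action:
  assumes "a \<in> actions y"
  obtains b where "b \<in> actions x" "dist1 b a \<le> dist1 x y"
proof (cases "max 0 (y Warehouse) \<le> max 0 (x Warehouse)")
  case True
  then have "a \<in> actions x"
    using assms by (auto simp: actions_def)
  then show thesis
    using that[of a] by (simp add: dist1_def sum_nonneg)
next
  case False
  define X Y c where "X = max 0 (x Warehouse)" and "Y = max 0 (y Warehouse)" and "c = X / Y"
  have XY: "0 \<le> X" "X < Y" "0 \<le> c" "c \<le> 1" "c * Y = X"
    using False by (auto simp: X_def Y_def c_def)
  \<comment> \<open>Only shipments draw on the warehouse stock, so the order is kept as it
    is.\<close>
  define b where "b n = (if n = Warehouse then a n else c * a n)" for n
  let ?s = "\<Sum>k\<in>stores P. a (Store k)"
  have s: "0 \<le> ?s" "?s \<le> Y"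
    using assms by (auto simp: actions_def Y_def intro!: sum_nonneg)
  have "(\<Sum>k\<in>stores P. b (Store k)) = c * ?s"
    by (simp add: b_def sum_distrib_left)
  also have "\<dots> \<le> X"
    using XY s by (metis mult_left_mono)
  finally have "b \<in> actions x"
    using assms XY by (auto simp: actions_def b_def X_def)
  moreover have "dist1 b a \<le> dist1 x y"
  proof -
    have "(\<Sum>k\<in>stores P. \<bar>b (Store k) - a (Store k)\<bar>) = (\<Sum>k\<in>stores P. (1 - c) * a (Store k))"
    proof (rule sum.cong[OF refl])
      fix k assume "k \<in> stores P"
      then have "0 \<le> (1 - c) * a (Store k)"
        using assms XY by (auto simp: actions_def)
      then show "\<bar>b (Store k) - a (Store k)\<bar> = (1 - c) * a (Store k)"
        by (simp add: b_def algebra_simps)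
    qed
    also have "\<dots> = (1 - c) * ?s"
      by (simp add: sum_distrib_left)
    also have "\<dots> \<le> (1 - c) * Y"
      using XY s by (intro mult_left_mono) auto
    also have "\<dots> = Y - X"
      using XY by (simp add: algebra_simps)
    also have "\<dots> \<le> \<bar>x Warehouse - y Warehouse\<bar>"
      by (simp add: X_def Y_def)
    also have "\<dots> \<le> dist1 x y"
      by (simp add: dist1_eq sum_nonneg)
    finally show ?thesis
      by (simp add: dist1_eq b_def)
  qed
  ultimately show thesis
    by (rule that)
qed

text \<open>Carrying an action over from \<open>y\<close> to \<open>x\<close> moves it by at most
  \<open>dist1 x y\<close>, so state and action together move by at most twice that distance. This
  doubles the constant of \<open>action_cost_lipschitz_aux\<close> to
  \<open>4 * (cost_rate + L)\<close>.\<close>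

lemma cost_to_go_lipschitz:
  "\<exists>L\<ge>0. \<forall>x y. cost_to_go r x \<le> cost_to_go r y + ennreal (L * dist1 x y)"
proof (induction r)
  case 0
  show ?case
    by (intro exI[of _ 0]) simp
next
  case (Suc r)
  then obtain L where L: "0 \<le> L" "\<And>x y. cost_to_go r x \<le> cost_to_go r y + ennreal (L * dist1 x y)"
    by blast
  have "cost_to_go (Suc r) x \<le> cost_to_go (Suc r) y + ennreal (4 * (cost_rate + L) * dist1 x y)" for x y
    unfolding cost_to_go_Suc
  proof (rule le_INF_add_ennreal)
    fix a assume "a \<in> actions y"
    then obtain b where b: "b \<in> actions x" "dist1 b a \<le> dist1 x y"
      by (rule nearby_action)
    have "(INF a\<in>actions x. action_cost r x a) \<le> action_cost r x b"
      using b(1) by (rule INF_lower)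
    also have "\<dots> \<le> action_cost r y a + ennreal (2 * (cost_rate + L) * (dist1 x y + dist1 b a))"
      by (rule action_cost_lipschitz_aux[OF L])
    also have "\<dots> \<le> action_cost r y a + ennreal (4 * (cost_rate + L) * dist1 x y)"
    proof (intro add_left_mono ennreal_leI)
      have "2 * (cost_rate + L) * (dist1 x y + dist1 b a) \<le> 2 * (cost_rate + L) * (dist1 x y + dist1 x y)"
        using b(2) cost_rate_nonneg L(1) by (intro mult_left_mono) auto
      then show "2 * (cost_rate + L) * (dist1 x y + dist1 b a) \<le> 4 * (cost_rate + L) * dist1 x y"
        by (simp add: algebra_simps)
    qed
    finally show "(INF a\<in>actions x. action_cost r x a) \<le> action_cost r y a + ennreal (4 * (cost_rate + L) * dist1 x y)" .
  qed
  then show ?case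
    using cost_rate_nonneg L(1) by (intro exI[of _ "4 * (cost_rate + L)"]) auto
qed

lemma action_cost_lipschitz:
  "\<exists>L\<ge>0. \<forall>x y a b. action_cost r x a \<le> action_cost r y b + ennreal (L * (dist1 x y + dist1 a b))"
proof -
  obtain L where L: "0 \<le> L" "\<And>x y. cost_to_go r x \<le> cost_to_go r y + ennreal (L * dist1 x y)"
    using cost_to_go_lipschitz by blast
  show ?thesis
    using action_cost_lipschitz_aux[OF L] cost_rate_nonneg L(1)
    by (intro exI[of _ "2 * (cost_rate + L)"]) auto
qed

lemma cost_to_go_cong:
  assumes "\<And>n. n \<in> stock_nodes P \<Longrightarrow> x n = y n"
  shows "cost_to_go r x = cost_to_go r y"
proof -
  have "dist1 x y = 0" "dist1 y x = 0"
    using assms by (simp_all add: dist1_def)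
  then show ?thesis
    using cost_to_go_lipschitz[of r] by (metis add.right_neutral ennreal_0 mult_zero_right order_antisym)
qed

lemma action_cost_cong:
  assumes "\<And>n. n \<in> stock_nodes P \<Longrightarrow> x n = y n" "\<And>n. n \<in> stock_nodes P \<Longrightarrow> a n = b n"
  shows "action_cost r x a = action_cost r y b"
proof -
  have "dist1 x y = 0" "dist1 y x = 0" "dist1 a b = 0" "dist1 b a = 0"
    using assms by (simp_all add: dist1_def)
  then show ?thesis
    using action_cost_lipschitz[of r] by (metis add.right_neutral ennreal_0 mult_zero_right order_antisym)
qed

lemma measurable_cost_to_go:
  assumes "\<And>n. n \<in> stock_nodes P \<Longrightarrow> (\<lambda>w. X w n) \<in> borel_measurable M"
  shows "(\<lambda>w. cost_to_go r (X w)) \<in> borel_measurable M"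
proof -
  obtain L where L: "0 \<le> L" "\<And>x y. cost_to_go r x \<le> cost_to_go r y + ennreal (L * dist1 x y)"
    using cost_to_go_lipschitz by blast
  show ?thesis
    by (rule borel_measurable_of_l1_bound[where S = "stock_nodes P" and L = L])
      (use L(2) assms in \<open>simp_all add: dist1_def\<close>)
qed

end

subsection \<open>Permutation of equal stores\<close>

lemma ennreal_of_nat_mult_le_cancel:
  fixes a b :: ennreal
  assumes "0 < n" "of_nat n * a \<le> of_nat n * b"
  shows "a \<le> b"
proof (rule ccontr)
  assume "\<not> a \<le> b"
  then have "of_nat n * b < of_nat n * a"
    using assms(1) by (intro ennreal_mult_strict_left_mono) (auto simp: of_nat_less_top)
  with assms(2) show False
    by simp
qed

text \<open>Convexity is used in the form of Jensen's inequality for uniform averages over a finite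
  family, with \<open>card A\<close> multiplied over to the other side to avoid division in
  \<open>ennreal\<close>.\<close>

definition average :: "'s set \<Rightarrow> ('s \<Rightarrow> node \<Rightarrow> real) \<Rightarrow> node \<Rightarrow> real" where
  "average A x n = (\<Sum>s\<in>A. x s n) / card A"

lemma max_0_sum_le: "max 0 (\<Sum>s\<in>A. f s) \<le> (\<Sum>s\<in>A. max 0 (f s :: real))"
  by (cases "finite A") (auto intro: sum_mono sum_nonneg)

text \<open>The dynamics is affine, and all members of the family face the same demand.\<close>

lemma next_inventory_average:
  assumes "finite A" "A \<noteq> {}"
  shows "next_inventory P (average A x) (average A a) d = average A (\<lambda>s. next_inventory P (x s) (a s) d)"
proof
  fix n
  have c: "real (card A) > 0"
    using assms by (simp add: card_gt_0_iff)
  have "(\<Sum>k\<in>stores P. \<Sum>s\<in>A. a s (Store k)) = (\<Sum>s\<in>A. \<Sum>k\<in>stores P. a s (Store k))"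
    by (rule sum.swap)
  then show "next_inventory P (average A x) (average A a) d n = average A (\<lambda>s. next_inventory P (x s) (a s) d) n"
    using c by (cases n)
      (simp_all add: average_def sum.distrib sum_subtractf sum_divide_distrib[symmetric] field_simps)
qed

context inventory_problem
begin

definition params :: "nat \<Rightarrow> real \<times> real \<times> real \<times> real" where
  "params k = (u_lo P k, u_hi P k, underage P k, holding P k)"

definition type_perms :: "(nat \<Rightarrow> nat) set" where
  "type_perms = {s. s permutes stores P \<and> (\<forall>k\<in>stores P. params (s k) = params k)}"

lemma type_permsD:
  assumes "s \<in> type_perms" "k \<in> stores P"
  shows "s k \<in> stores P" "u_lo P (s k) = u_lo P k" "u_hi P (s k) = u_hi P k"
    "underage P (s k) = underage P k" "holding P (s k) = holding P k"
  using assms permutes_in_image[of s "stores P" k] by (auto simp: type_perms_def params_def)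

lemma type_perms_inv:
  assumes "s \<in> type_perms"
  shows "inv s \<in> type_perms" "perm_state s (perm_state (inv s) x) = x" "perm_state (inv s) (perm_state s x) = x"
proof -
  have p: "s permutes stores P" and q: "\<And>k. k \<in> stores P \<Longrightarrow> params (s k) = params k"
    using assms by (auto simp: type_perms_def)
  have "params (inv s k) = params k" if "k \<in> stores P" for k
    using q[of "inv s k"] permutes_in_image[OF permutes_inv[OF p], of k] that permutes_inverses(1)[OF p, of k]
    by simp
  then show "inv s \<in> type_perms"
    using permutes_inv[OF p] by (simp add: type_perms_def)
  show "perm_state s (perm_state (inv s) x) = x" "perm_state (inv s) (perm_state s x) = x"
    using permutes_inverses[OF p] by (auto simp: perm_state_def fun_eq_iff split: node.split)
qed

lemma sum_type_perm:
  assumes "s \<in> type_perms"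
  shows "(\<Sum>k\<in>stores P. f (s k)) = (\<Sum>k\<in>stores P. f k)"
  using sum.permute[of s "stores P" f] assms by (simp add: type_perms_def comp_def)

lemma perm_state_in_actions:
  assumes "s \<in> type_perms" "a \<in> actions x" "y Warehouse = x Warehouse"
  shows "perm_state s a \<in> actions y"
proof -
  have "0 \<le> perm_state s a n" if "n \<in> stock_nodes P" for n
    using assms that type_permsD(1)[OF assms(1)] by (cases n) (auto simp: actions_def)
  moreover have "(\<Sum>k\<in>stores P. perm_state s a (Store k)) = (\<Sum>k\<in>stores P. a (Store k))"
    using sum_type_perm[OF assms(1), of "\<lambda>k. a (Store k)"] by simp
  ultimately show ?thesis
    using assms by (auto simp: actions_def)
qed

lemma measurable_stage_cost:
  "(\<lambda>z. ennreal (period_cost P x a (draw z)) + cost_to_go r (next_inventory P x a (draw z)))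
     \<in> borel_measurable (period_law P)"
proof -
  have "(\<lambda>z. cost_to_go r (next_inventory P x a (draw z))) \<in> borel_measurable (period_law P)"
  proof (rule measurable_cost_to_go)
    fix n assume "n \<in> stock_nodes P"
    then show "(\<lambda>z. next_inventory P x a (draw z) n) \<in> borel_measurable (period_law P)"
      by (cases n) (auto intro!: borel_measurable_diff measurable_draw)
  qed
  moreover have "(\<lambda>z. period_cost P x a (draw z)) \<in> borel_measurable (period_law P)"
    unfolding period_cost_def
    by (intro borel_measurable_add borel_measurable_sum borel_measurable_times borel_measurable_max
        borel_measurable_diff measurable_draw) auto
  ultimately show ?thesis
    by measurable
qed

text \<open>The restriction to \<open>stores P\<close> keeps the result inside the space of the
  product measure.\<close>

definition relabel :: "(nat \<Rightarrow> nat) \<Rightarrow> real \<times> (nat \<Rightarrow> real) \<Rightarrow> real \<times> (nat \<Rightarrow> real)" where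
  "relabel s z = (fst z, \<lambda>k\<in>stores P. snd z (s k))"

lemma draw_relabel: "k \<in> stores P \<Longrightarrow> draw (relabel s z) k = draw z (s k)"
  by (simp add: draw_def relabel_def)

text \<open>The factor \<open>B\<close> is common to all stores and stays as it is; \<open>s\<close>
  permutes independent coordinates with equal laws.\<close>

lemma distr_relabel:
  assumes s: "s \<in> type_perms"
  shows "relabel s \<in> measurable (period_law P) (period_law P)"
    and "distr (period_law P) (period_law P) (relabel s) = period_law P"
proof -
  define U where "U k = uniform_measure lborel {u_lo P k..u_hi P k}" for k
  define B where "B = distr (measure_pmf (bernoulli_pmf (prob_high P))) borel (\<lambda>b. if b then gamma_H P else gamma_L P)"
  have law: "period_law P = B \<Otimes>\<^sub>M PiM (stores P) U"
    by (simp add: period_law_def B_def U_def[abs_def])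
  have s_in: "s \<in> stores P \<rightarrow> stores P"
    using type_permsD(1)[OF s] by (rule Pi_I)
  have U: "PiM (stores P) (\<lambda>k. U (s k)) = PiM (stores P) U"
    using s by (intro PiM_cong) (auto simp: U_def type_permsD)
  have perm: "s permutes stores P"
    using s by (simp add: type_perms_def)
  have m: "(\<lambda>w. \<lambda>k\<in>stores P. w (s k)) \<in> measurable (PiM (stores P) U) (PiM (stores P) U)"
  proof -
    have "(\<lambda>w. \<lambda>k\<in>stores P. w (s k)) \<in> measurable (PiM (stores P) U) (PiM (stores P) (\<lambda>k. U (s k)))"
      by (intro measurable_restrict measurable_component_singleton type_permsD(1)[OF s])
    then show ?thesis
      unfolding U .
  qed
  have d: "distr (PiM (stores P) U) (PiM (stores P) U) (\<lambda>w. \<lambda>k\<in>stores P. w (s k)) = PiM (stores P) U"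
    using distr_PiM_reindex[of "stores P" U s "stores P", OF _ permutes_inj_on[OF perm] s_in] prob_space_U
    unfolding U by (simp add: U_def)
  interpret U: prob_space "PiM (stores P) U"
    using prob_space_U_PiM by (simp add: U_def[abs_def])
  interpret B: prob_space B
    using prob_space_B by (simp add: B_def)
  have r: "relabel s = (\<lambda>(b, w). (b, \<lambda>k\<in>stores P. w (s k)))"
    by (auto simp: relabel_def fun_eq_iff)
  show "relabel s \<in> measurable (period_law P) (period_law P)"
    unfolding r law using m by measurable
  have "distr B B (\<lambda>x. x) \<Otimes>\<^sub>M distr (PiM (stores P) U) (PiM (stores P) U) (\<lambda>w. \<lambda>k\<in>stores P. w (s k))
      = distr (period_law P) (period_law P) (relabel s)"
    unfolding r law
    by (rule pair_measure_distr) (use m in \<open>simp_all only: d U.sigma_finite_measure_axioms measurable_ident_sets\<close>)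
  then show "distr (period_law P) (period_law P) (relabel s) = period_law P"
    unfolding d by (simp add: law)
qed

lemma period_cost_perm:
  assumes "s \<in> type_perms" "\<And>k. k \<in> stores P \<Longrightarrow> e k = d (s k)"
  shows "period_cost P (perm_state s x) (perm_state s a) e = period_cost P x a d"
proof -
  let ?g = "\<lambda>k. underage P k * max 0 (d k - x (Store k) - a (Store k)) +
        holding P k * max 0 (x (Store k) + a (Store k) - d k)"
  have "(\<Sum>k\<in>stores P. underage P k * max 0 (e k - x (Store (s k)) - a (Store (s k))) +
        holding P k * max 0 (x (Store (s k)) + a (Store (s k)) - e k)) = (\<Sum>k\<in>stores P. ?g (s k))"
    using assms by (intro sum.cong) (auto simp: type_permsD)
  also have "\<dots> = (\<Sum>k\<in>stores P. ?g k)"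
    by (rule sum_type_perm[OF assms(1)])
  finally show ?thesis
    using sum_type_perm[OF assms(1), of "\<lambda>k. a (Store k)"] by (simp add: period_cost_def)
qed

text \<open>Change of variables: relabelled demand has the same law, and under it state, action and
  demand are all permuted by \<open>s\<close>.\<close>

lemma action_cost_perm_aux:
  assumes s: "s \<in> type_perms" and inv: "\<And>x. cost_to_go r (perm_state s x) = cost_to_go r x"
  shows "action_cost r (perm_state s x) (perm_state s a) = action_cost r x a"
proof -
  let ?f = "\<lambda>z. ennreal (period_cost P (perm_state s x) (perm_state s a) (draw z)) +
      cost_to_go r (next_inventory P (perm_state s x) (perm_state s a) (draw z))"
  have "action_cost r (perm_state s x) (perm_state s a) = (\<integral>\<^sup>+z. ?f z \<partial>distr (period_law P) (period_law P) (relabel s))"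
    by (simp add: action_cost_def distr_relabel(2)[OF s])
  also have "\<dots> = (\<integral>\<^sup>+z. ?f (relabel s z) \<partial>period_law P)"
    by (intro nn_integral_distr distr_relabel(1)[OF s]) (simp add: measurable_stage_cost)
  also have "\<dots> = action_cost r x a"
    unfolding action_cost_def
  proof (rule nn_integral_cong)
    fix z
    have "cost_to_go r (next_inventory P (perm_state s x) (perm_state s a) (draw (relabel s z)))
        = cost_to_go r (perm_state s (next_inventory P x a (draw z)))"
    proof (rule cost_to_go_cong)
      fix n assume "n \<in> stock_nodes P"
      then show "next_inventory P (perm_state s x) (perm_state s a) (draw (relabel s z)) n
          = perm_state s (next_inventory P x a (draw z)) n"
        using sum_type_perm[OF s, of "\<lambda>k. a (Store k)"] by (cases n) (auto simp: draw_relabel)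
    qed
    then show "?f (relabel s z) =
        ennreal (period_cost P x a (draw z)) + cost_to_go r (next_inventory P x a (draw z))"
      using period_cost_perm[OF s, of "draw (relabel s z)" "draw z" x a] by (simp add: draw_relabel inv)
  qed
  finally show ?thesis .
qed

text \<open>Permuted actions remain available, which gives one inequality for every
  \<open>s\<close>; applied to \<open>inv s\<close> it gives the other.\<close>

lemma cost_to_go_perm: "s \<in> type_perms \<Longrightarrow> cost_to_go r (perm_state s x) = cost_to_go r x"
proof (induction r arbitrary: s x)
  case (Suc r)
  have le: "cost_to_go (Suc r) (perm_state s x) \<le> cost_to_go (Suc r) x" if s: "s \<in> type_perms" for s x
    unfolding cost_to_go_Suc
  proof (rule INF_greatest)
    fix a assume a: "a \<in> actions x"
    have "(INF a\<in>actions (perm_state s x). action_cost r (perm_state s x) a)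
        \<le> action_cost r (perm_state s x) (perm_state s a)"
      using perm_state_in_actions[OF s a, of "perm_state s x"] by (intro INF_lower) simp
    then show "(INF a\<in>actions (perm_state s x). action_cost r (perm_state s x) a) \<le> action_cost r x a"
      using action_cost_perm_aux[OF s Suc.IH[OF s]] by simp
  qed
  show ?case
    using le[OF Suc.prems, of x] le[OF type_perms_inv(1)[OF Suc.prems], of "perm_state s x"]
      type_perms_inv(3)[OF Suc.prems] by (simp add: order_antisym)
qed simp

lemma action_cost_perm:
  "s \<in> type_perms \<Longrightarrow> action_cost r (perm_state s x) (perm_state s a) = action_cost r x a"
  by (intro action_cost_perm_aux cost_to_go_perm)

subsection \<open>Convexity\<close>

text \<open>All terms are linear except the positive parts, which are subadditive and positively
  homogeneous.\<close>

lemma period_cost_average: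
  fixes x a :: "'a \<Rightarrow> node \<Rightarrow> real"
  assumes A: "finite A" "A \<noteq> {}"
  shows "real (card A) * period_cost P (average A x) (average A a) d \<le> (\<Sum>s\<in>A. period_cost P (x s) (a s) d)"
proof -
  have c: "real (card A) > 0"
    using A by (simp add: card_gt_0_iff)
  have pos: "real (card A) * max 0 t = max 0 (real (card A) * t)" for t
    using c by (simp add: max_def zero_le_mult_iff)
  have av: "real (card A) * average A y n = (\<Sum>s\<in>A. y s n)" for y n
    using c by (simp add: average_def)
  have swap: "(\<Sum>k\<in>stores P. \<Sum>s\<in>A. f k s) = (\<Sum>s\<in>A. \<Sum>k\<in>stores P. f k s)" for f :: "nat \<Rightarrow> 'a \<Rightarrow> real"
    by (rule sum.swap)
  have w: "real (card A) * (average A x Warehouse - (\<Sum>k\<in>stores P. average A a (Store k)))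
      = (\<Sum>s\<in>A. x s Warehouse - (\<Sum>k\<in>stores P. a s (Store k)))"
    by (simp add: right_diff_distrib av sum_distrib_left sum_subtractf swap del: One_nat_def)
  have lt: "real (card A) * max 0 (d k - average A x (Store k) - average A a (Store k))
      \<le> (\<Sum>s\<in>A. max 0 (d k - x s (Store k) - a s (Store k)))" for k
    unfolding pos using max_0_sum_le[of "\<lambda>s. d k - x s (Store k) - a s (Store k)" A]
    by (simp add: right_diff_distrib av sum_subtractf)
  have gt: "real (card A) * max 0 (average A x (Store k) + average A a (Store k) - d k)
      \<le> (\<Sum>s\<in>A. max 0 (x s (Store k) + a s (Store k) - d k))" for k
    unfolding pos using max_0_sum_le[of "\<lambda>s. x s (Store k) + a s (Store k) - d k" A]
    by (simp add: right_diff_distrib distrib_left av sum_subtractf sum.distrib)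
  have "real (card A) * period_cost P (average A x) (average A a) d =
      holding_w P * (real (card A) * (average A x Warehouse - (\<Sum>k\<in>stores P. average A a (Store k)))) +
      (\<Sum>k\<in>stores P.
        underage P k * (real (card A) * max 0 (d k - average A x (Store k) - average A a (Store k))) +
        holding P k * (real (card A) * max 0 (average A x (Store k) + average A a (Store k) - d k)))"
    unfolding period_cost_def distrib_left sum_distrib_left
    by (simp only: mult.left_commute[of "real (card A)"])
  also have "\<dots> \<le> holding_w P * (\<Sum>s\<in>A. x s Warehouse - (\<Sum>k\<in>stores P. a s (Store k))) +
      (\<Sum>k\<in>stores P.
        underage P k * (\<Sum>s\<in>A. max 0 (d k - x s (Store k) - a s (Store k))) +
        holding P k * (\<Sum>s\<in>A. max 0 (x s (Store k) + a s (Store k) - d k)))"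
    unfolding w using lt gt underage_pos holding_nonneg
    by (intro add_left_mono sum_mono add_mono mult_left_mono) (auto intro: less_imp_le)
  also have "\<dots> = (\<Sum>s\<in>A. period_cost P (x s) (a s) d)"
    unfolding period_cost_def sum.distrib sum_distrib_left
    by (simp only: swap)
  finally show ?thesis .
qed

text \<open>The bound \<open>max 0\<close> on the shipments is convex, not concave, in the stock.
  Where stocks are nonnegative it is linear, and there the constraint is jointly convex in state and
  action.\<close>

lemma average_in_actions:
  assumes A: "finite A" "A \<noteq> {}"
    and x: "\<And>s. s \<in> A \<Longrightarrow> 0 \<le> x s Warehouse" and a: "\<And>s. s \<in> A \<Longrightarrow> a s \<in> actions (x s)"
  shows "average A a \<in> actions (average A x)"
proof -
  have "0 \<le> average A a n" if "n \<in> stock_nodes P" for n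
    using that a by (auto simp: average_def actions_def intro!: divide_nonneg_nonneg sum_nonneg)
  moreover have "(\<Sum>k\<in>stores P. average A a (Store k)) \<le> average A x Warehouse"
  proof -
    have "(\<Sum>k\<in>stores P. average A a (Store k)) = (\<Sum>s\<in>A. \<Sum>k\<in>stores P. a s (Store k)) / card A"
      unfolding average_def sum_divide_distrib[symmetric] by (subst sum.swap) (rule refl)
    also have "\<dots> \<le> (\<Sum>s\<in>A. x s Warehouse) / card A"
      using a x by (intro divide_right_mono sum_mono) (auto simp: actions_def max_def)
    finally show ?thesis
      by (simp add: average_def)
  qed
  ultimately show ?thesis
    by (auto simp: actions_def)
qed

lemma action_cost_average_aux:
  assumes A: "finite A" "A \<noteq> {}"
    and x: "\<And>s. s \<in> A \<Longrightarrow> 0 \<le> x s Warehouse" and a: "\<And>s. s \<in> A \<Longrightarrow> a s \<in> actions (x s)"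
    and IH: "\<And>x. (\<And>s. s \<in> A \<Longrightarrow> 0 \<le> x s Warehouse) \<Longrightarrow>
      of_nat (card A) * cost_to_go r (average A x) \<le> (\<Sum>s\<in>A. cost_to_go r (x s))"
  shows "of_nat (card A) * action_cost r (average A x) (average A a) \<le> (\<Sum>s\<in>A. action_cost r (x s) (a s))"
proof -
  have "of_nat (card A) * action_cost r (average A x) (average A a) =
     (\<integral>\<^sup>+z. of_nat (card A) * (ennreal (period_cost P (average A x) (average A a) (draw z)) +
        cost_to_go r (next_inventory P (average A x) (average A a) (draw z))) \<partial>period_law P)"
    unfolding action_cost_def by (intro nn_integral_cmult[symmetric] measurable_stage_cost)
  also have "\<dots> \<le> (\<integral>\<^sup>+z. (\<Sum>s\<in>A. ennreal (period_cost P (x s) (a s) (draw z)) +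
        cost_to_go r (next_inventory P (x s) (a s) (draw z))) \<partial>period_law P)"
  proof (rule nn_integral_mono)
    fix z
    have nonneg: "0 \<le> period_cost P (x s) (a s) (draw z)" if "s \<in> A" for s
      using actions_imp_feasible_action[OF a[OF that] x[OF that]] by (rule period_cost_nonneg)
    have "of_nat (card A) * ennreal (period_cost P (average A x) (average A a) (draw z))
        \<le> ennreal (\<Sum>s\<in>A. period_cost P (x s) (a s) (draw z))"
      using period_cost_average[OF A, of x a "draw z"]
      by (simp add: ennreal_of_nat_eq_real_of_nat ennreal_mult'[symmetric] ennreal_leI)
    also have "\<dots> = (\<Sum>s\<in>A. ennreal (period_cost P (x s) (a s) (draw z)))"
      using nonneg by (simp add: sum_ennreal)
    finally have 1: "of_nat (card A) * ennreal (period_cost P (average A x) (average A a) (draw z))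
        \<le> (\<Sum>s\<in>A. ennreal (period_cost P (x s) (a s) (draw z)))" .
    have 2: "of_nat (card A) * cost_to_go r (next_inventory P (average A x) (average A a) (draw z))
        \<le> (\<Sum>s\<in>A. cost_to_go r (next_inventory P (x s) (a s) (draw z)))"
      unfolding next_inventory_average[OF A]
    proof (rule IH)
      \<comment> \<open>Shipments never exceed a nonnegative stock, so the next warehouse stock is
        nonnegative and \<open>IH\<close> applies.\<close>
      fix s assume "s \<in> A"
      then show "0 \<le> next_inventory P (x s) (a s) (draw z) Warehouse"
        using a[of s] x[of s] by (auto simp: actions_def intro!: add_increasing2)
    qed
    show "of_nat (card A) * (ennreal (period_cost P (average A x) (average A a) (draw z)) +
        cost_to_go r (next_inventory P (average A x) (average A a) (draw z)))
        \<le> (\<Sum>s\<in>A. ennreal (period_cost P (x s) (a s) (draw z)) +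
        cost_to_go r (next_inventory P (x s) (a s) (draw z)))"
      unfolding distrib_left sum.distrib by (intro add_mono 1 2)
  qed
  also have "\<dots> = (\<Sum>s\<in>A. action_cost r (x s) (a s))"
    unfolding action_cost_def by (intro nn_integral_sum measurable_stage_cost)
  finally show ?thesis .
qed

text \<open>Minimising a jointly convex function over one of its arguments leaves a convex function:
  the average of nearly optimal actions is a candidate at the average state.\<close>

lemma cost_to_go_average:
  assumes "finite A" "A \<noteq> {}" "\<And>s. s \<in> A \<Longrightarrow> 0 \<le> x s Warehouse"
  shows "of_nat (card A) * cost_to_go r (average A x) \<le> (\<Sum>s\<in>A. cost_to_go r (x s))"
  using assms
proof (induction r arbitrary: x)
  case (Suc r)
  show ?case
  proof (rule ennreal_le_epsilon)
    fix e :: real assume "0 < e"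
    \<comment> \<open>The errors of the \<open>card A\<close> chosen actions add up to
      \<open>e\<close>.\<close>
    define e' where "e' = e / card A"
    have c: "real (card A) > 0"
      using Suc.prems by (simp add: card_gt_0_iff)
    have "0 < e'"
      using \<open>0 < e\<close> c by (simp add: e'_def)
    then have "\<exists>a\<in>actions (x s). action_cost r (x s) a \<le> cost_to_go (Suc r) (x s) + ennreal e'" for s
      unfolding cost_to_go_Suc using zero_in_actions by (intro INF_ennreal_near) auto
    then obtain a where a: "\<And>s. a s \<in> actions (x s)"
      "\<And>s. action_cost r (x s) (a s) \<le> cost_to_go (Suc r) (x s) + ennreal e'"
      by metis
    have "of_nat (card A) * cost_to_go (Suc r) (average A x)
        \<le> of_nat (card A) * action_cost r (average A x) (average A a)"
      unfolding cost_to_go_Suc using Suc.prems a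
      by (intro mult_left_mono INF_lower average_in_actions) auto
    also have "\<dots> \<le> (\<Sum>s\<in>A. action_cost r (x s) (a s))"
      using Suc a by (intro action_cost_average_aux) auto
    also have "\<dots> \<le> (\<Sum>s\<in>A. cost_to_go (Suc r) (x s) + ennreal e')"
      by (intro sum_mono a)
    also have "\<dots> = (\<Sum>s\<in>A. cost_to_go (Suc r) (x s)) + ennreal e"
      using c \<open>0 < e'\<close> by (simp add: sum.distrib e'_def ennreal_of_nat_eq_real_of_nat ennreal_mult'[symmetric])
    finally show "of_nat (card A) * cost_to_go (Suc r) (average A x)
        \<le> (\<Sum>s\<in>A. cost_to_go (Suc r) (x s)) + ennreal e" .
  qed
qed simp

lemma action_cost_average:
  assumes "finite A" "A \<noteq> {}" "\<And>s. s \<in> A \<Longrightarrow> 0 \<le> x s Warehouse" "\<And>s. s \<in> A \<Longrightarrow> a s \<in> actions (x s)"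
  shows "of_nat (card A) * action_cost r (average A x) (average A a) \<le> (\<Sum>s\<in>A. action_cost r (x s) (a s))"
  using assms by (intro action_cost_average_aux cost_to_go_average)

text \<open>A nearly optimal action is averaged over the permutations of equal stores that fix the state.\<close>

lemma symmetric_near_optimal_action:
  assumes x: "0 \<le> x Warehouse" and e: "0 < e"
  obtains a where "a \<in> actions x" "action_cost r x a \<le> cost_to_go (Suc r) x + ennreal e"
    "\<And>j k. j \<in> stores P \<Longrightarrow> k \<in> stores P \<Longrightarrow> params j = params k \<Longrightarrow> x (Store j) = x (Store k) \<Longrightarrow>
      a (Store j) = a (Store k)"
proof -
  have "\<exists>a\<in>actions x. action_cost r x a \<le> cost_to_go (Suc r) x + ennreal e"
    unfolding cost_to_go_Suc using zero_in_actions e by (intro INF_ennreal_near) auto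
  then obtain a0 where a0: "a0 \<in> actions x" "action_cost r x a0 \<le> cost_to_go (Suc r) x + ennreal e"
    by blast
  \<comment> \<open>The stabiliser of \<open>x\<close> among the permutations of equal
    stores.\<close>
  define A where "A = {s \<in> type_perms. \<forall>k. x (Store (s k)) = x (Store k)}"
  have "finite A"
    by (rule finite_subset[OF _ finite_permutations[of "stores P"]]) (auto simp: A_def type_perms_def)
  moreover have "id \<in> A"
    by (simp add: A_def type_perms_def permutes_id)
  ultimately have A: "finite A" "A \<noteq> {}"
    by auto
  have c: "0 < card A"
    using A by (simp add: card_gt_0_iff)
  have fix_x: "perm_state s x = x" if "s \<in> A" for s
    using that by (auto simp: A_def perm_state_def fun_eq_iff split: node.split)
  have in_A: "perm_state s a0 \<in> actions x" if "s \<in> A" for s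
    using that a0(1) by (intro perm_state_in_actions) (auto simp: A_def)
  define a where "a = average A (\<lambda>s. perm_state s a0)"
  have const: "average A (\<lambda>_. x) = x"
    using c by (simp add: average_def fun_eq_iff)
  have a_in: "a \<in> actions x"
    using average_in_actions[OF A, of "\<lambda>_. x" "\<lambda>s. perm_state s a0"] x in_A by (simp add: const a_def)
  have "of_nat (card A) * action_cost r x a \<le> (\<Sum>s\<in>A. action_cost r x (perm_state s a0))"
    using action_cost_average[OF A, of "\<lambda>_. x" "\<lambda>s. perm_state s a0"] x in_A by (simp add: const a_def)
  also have "\<dots> = (\<Sum>s\<in>A. action_cost r x a0)"
  proof (rule sum.cong[OF refl])
    fix s assume "s \<in> A"
    then show "action_cost r x (perm_state s a0) = action_cost r x a0"
      using action_cost_perm[of s r x a0] fix_x[of s] by (simp add: A_def)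
  qed
  also have "\<dots> = of_nat (card A) * action_cost r x a0"
    by simp
  finally have "action_cost r x a \<le> action_cost r x a0"
    by (rule ennreal_of_nat_mult_le_cancel[OF c])
  then have a_opt: "action_cost r x a \<le> cost_to_go (Suc r) x + ennreal e"
    using a0(2) by (rule order_trans)
  have "a (Store j) = a (Store k)"
    if jk: "j \<in> stores P" "k \<in> stores P" "params j = params k" "x (Store j) = x (Store k)" for j k
  proof -
    \<comment> \<open>Composition with the transposition of \<open>j\<close> and \<open>k\<close> is
      an involution of \<open>A\<close> that exchanges the two sums to be compared.\<close>
    let ?t = "Transposition.transpose j k"
    have t: "?t permutes stores P"
      by (rule permutes_swap_id[OF jk(1,2)])
    have tp: "params (?t i) = params i" "x (Store (?t i)) = x (Store i)" for i
      using jk(3,4) by (auto simp: Transposition.transpose_def)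
    have comp: "s \<circ> ?t \<in> A" if "s \<in> A" for s
    proof -
      have s: "s permutes stores P" "\<forall>k\<in>stores P. params (s k) = params k"
        "\<forall>k. x (Store (s k)) = x (Store k)"
        using that by (simp_all add: A_def type_perms_def)
      have "params (s (?t i)) = params i" if "i \<in> stores P" for i
        using s(2) permutes_in_image[OF t, of i] that tp(1)[of i] by metis
      moreover have "x (Store (s (?t i))) = x (Store i)" for i
        using s(3) tp(2)[of i] by metis
      ultimately show ?thesis
        using permutes_compose[OF t s(1)] by (simp add: A_def type_perms_def)
    qed
    have "(\<Sum>s\<in>A. a0 (Store (s j))) = (\<Sum>s\<in>A. a0 (Store (s k)))"
      by (rule sum.reindex_bij_witness[of _ "\<lambda>s. s \<circ> ?t" "\<lambda>s. s \<circ> ?t"])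
        (use comp in \<open>simp_all add: comp_assoc\<close>)
    then show ?thesis
      by (simp add: a_def average_def)
  qed
  with a_in a_opt show thesis
    by (rule that)
qed

end

section \<open>Comparison of policies with the cost-to-go\<close>

context inventory_problem
begin

sublocale sample: product_prob_space "\<lambda>_. period_law P" "periods P"
  by unfold_locales

lemma prob_space_sample_law: "prob_space (sample_law P)"
  unfolding sample_law_def by (intro prob_space_PiM prob_space_period_law)

sublocale sample: prob_space "sample_law P"
  by (rule prob_space_sample_law)

lemma nn_integral_sample_update:
  assumes "t \<in> periods P" "f \<in> borel_measurable (sample_law P)"
  shows "(\<integral>\<^sup>+w. f w \<partial>sample_law P) = (\<integral>\<^sup>+w. (\<integral>\<^sup>+z. f (w(t := z)) \<partial>period_law P) \<partial>sample_law P)"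
  using sample.nn_integral_PiM_update[of t f] assms unfolding sample_law_def by simp

lemma demand_eq_draw: "demand w t = draw (w t)"
  by (simp add: demand_def draw_def fun_eq_iff)

lemma measurable_demand:
  assumes "t \<in> periods P" "k \<in> stores P"
  shows "(\<lambda>w. demand w t k) \<in> borel_measurable (sample_law P)"
  unfolding demand_eq_draw sample_law_def
  by (rule measurable_compose[OF measurable_component_singleton[OF assms(1)] measurable_draw[OF assms(2)]])

lemma measurable_history:
  assumes "t \<in> periods P"
  shows "(\<lambda>w. history P t (demand w)) \<in> measurable (sample_law P) (history_space P t)"
  unfolding history_def history_space_def using assms
  by (intro measurable_restrict measurable_demand) auto

definition measurable_policy :: "policy \<Rightarrow> bool" where
  "measurable_policy \<pi> \<longleftrightarrow>
     (\<forall>t\<in>periods P. \<forall>n\<in>stock_nodes P. (\<lambda>d. \<pi> t d n) \<in> borel_measurable (history_space P t))"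

lemma measurable_action:
  assumes "measurable_policy \<pi>" "t \<in> periods P" "n \<in> stock_nodes P"
  shows "(\<lambda>w. \<pi> t (history P t (demand w)) n) \<in> borel_measurable (sample_law P)"
  using assms by (intro measurable_compose[OF measurable_history]) (auto simp: measurable_policy_def)

lemma measurable_inventory:
  assumes "measurable_policy \<pi>" "t \<le> Suc (horizon P)" "n \<in> stock_nodes P"
  shows "(\<lambda>w. inventory P \<pi> (demand w) t n) \<in> borel_measurable (sample_law P)"
  using assms(2,3)
proof (induction t arbitrary: n)
  case (Suc t)
  show ?case
  proof (cases "t = 0")
    case False
    then have t: "t \<in> periods P"
      using Suc.prems by simp
    show ?thesis
      using False Suc t
      by (cases n) (auto intro!: borel_measurable_add borel_measurable_diff borel_measurable_sum
          measurable_action[OF assms(1)] measurable_demand)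
  qed simp
qed simp

lemma demand_update:
  "s \<noteq> t \<Longrightarrow> demand (w(t := z)) s = demand w s" "demand (w(t := z)) t = draw z"
  by (simp_all add: demand_eq_draw)

text \<open>Non-anticipation: the case \<open>s = t\<close> is included because the demand of period
  \<open>t\<close> is not yet known when period \<open>t\<close> is decided.\<close>

lemma history_update: "s \<le> t \<Longrightarrow> history P s (demand (w(t := z))) = history P s (demand w)"
  by (auto simp: history_def fun_eq_iff restrict_def demand_update)

lemma inventory_update: "s \<le> t \<Longrightarrow> inventory P \<pi> (demand (w(t := z))) s = inventory P \<pi> (demand w) s"
  by (induction s) (auto simp: history_update demand_update)

definition stage_cost :: "policy \<Rightarrow> (nat \<Rightarrow> real \<times> (nat \<Rightarrow> real)) \<Rightarrow> nat \<Rightarrow> real" where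
  "stage_cost \<pi> w t =
     period_cost P (inventory P \<pi> (demand w) t) (\<pi> t (history P t (demand w))) (demand w t)"

lemma stage_cost_update: "s < t \<Longrightarrow> stage_cost \<pi> (w(t := z)) s = stage_cost \<pi> w s"
  by (simp add: stage_cost_def history_update inventory_update demand_update)

lemma measurable_stage_cost_sample:
  assumes "measurable_policy \<pi>" "t \<in> periods P"
  shows "(\<lambda>w. stage_cost \<pi> w t) \<in> borel_measurable (sample_law P)"
proof -
  have t: "t \<le> Suc (horizon P)"
    using assms(2) by simp
  show ?thesis
    unfolding stage_cost_def period_cost_def
    by (intro borel_measurable_add borel_measurable_sum borel_measurable_times borel_measurable_max
      borel_measurable_diff borel_measurable_const measurable_demand[OF assms(2)] measurable_action[OF assms]
      measurable_inventory[OF assms(1) t]) simp_all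
qed

lemma measurable_past_cost:
  assumes "measurable_policy \<pi>" "t \<le> Suc (horizon P)"
  shows "(\<lambda>w. \<Sum>s\<in>{1..<t}. ennreal (stage_cost \<pi> w s)) \<in> borel_measurable (sample_law P)"
proof (rule borel_measurable_sum)
  fix s assume "s \<in> {1..<t}"
  then have "s \<in> periods P"
    using assms(2) by auto
  from measurable_stage_cost_sample[OF assms(1) this]
  show "(\<lambda>w. ennreal (stage_cost \<pi> w s)) \<in> borel_measurable (sample_law P)"
    by measurable
qed

text \<open>Expected cost incurred before period \<open>t\<close>, plus the optimal cost-to-go from
  the state reached. It interpolates between the cost-to-go of the initial state at
  \<open>t = 1\<close> and the cost of the policy at \<open>t = horizon P + 1\<close>, so policies
  are compared with the optimum one period at a time.\<close>

definition running_cost :: "policy \<Rightarrow> nat \<Rightarrow> ennreal" where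
  "running_cost \<pi> t = (\<integral>\<^sup>+w. (\<Sum>s\<in>{1..<t}. ennreal (stage_cost \<pi> w s)) +
     cost_to_go (Suc (horizon P) - t) (inventory P \<pi> (demand w) t) \<partial>sample_law P)"

text \<open>Resampling the demand of period \<open>t\<close> affects neither the earlier costs nor
  the inventory and the action at \<open>t\<close>; integrating it out produces
  \<open>action_cost\<close>.\<close>

lemma running_cost_Suc:
  assumes \<pi>: "measurable_policy \<pi>" and t: "t \<in> periods P"
  shows "running_cost \<pi> (Suc t) = (\<integral>\<^sup>+w. (\<Sum>s\<in>{1..<t}. ennreal (stage_cost \<pi> w s)) +
     action_cost (horizon P - t) (inventory P \<pi> (demand w) t) (\<pi> t (history P t (demand w))) \<partial>sample_law P)"
proof -
  let ?r = "horizon P - t"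
  let ?f = "\<lambda>w. (\<Sum>s\<in>{1..<Suc t}. ennreal (stage_cost \<pi> w s)) +
     cost_to_go ?r (inventory P \<pi> (demand w) (Suc t))"
  have "?f \<in> borel_measurable (sample_law P)"
    using t by (intro borel_measurable_add measurable_past_cost \<pi> measurable_cost_to_go measurable_inventory) auto
  then have "running_cost \<pi> (Suc t) = (\<integral>\<^sup>+w. (\<integral>\<^sup>+z. ?f (w(t := z)) \<partial>period_law P) \<partial>sample_law P)"
    unfolding running_cost_def using nn_integral_sample_update[OF t, of ?f] by simp
  also have "\<dots> = (\<integral>\<^sup>+w. (\<Sum>s\<in>{1..<t}. ennreal (stage_cost \<pi> w s)) +
     action_cost ?r (inventory P \<pi> (demand w) t) (\<pi> t (history P t (demand w))) \<partial>sample_law P)"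
  proof (rule nn_integral_cong)
    fix w
    let ?x = "inventory P \<pi> (demand w) t" and ?a = "\<pi> t (history P t (demand w))"
    have "?f (w(t := z)) = (\<Sum>s\<in>{1..<t}. ennreal (stage_cost \<pi> w s)) +
        (ennreal (period_cost P ?x ?a (draw z)) + cost_to_go ?r (next_inventory P ?x ?a (draw z)))" for z
    proof -
      have "{1..<Suc t} = insert t {1..<t}"
        using t by auto
      then show ?thesis
        using t by (simp add: stage_cost_update stage_cost_def[of _ _ t] history_update inventory_update
            demand_update ac_simps del: One_nat_def)
    qed
    then show "(\<integral>\<^sup>+z. ?f (w(t := z)) \<partial>period_law P) =
        (\<Sum>s\<in>{1..<t}. ennreal (stage_cost \<pi> w s)) + action_cost ?r ?x ?a"
      by (simp add: action_cost_def nn_integral_add measurable_stage_cost period.emeasure_space_1 del: One_nat_def)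
  qed
  finally show ?thesis .
qed

lemma running_cost_1: "running_cost \<pi> 1 = cost_to_go (horizon P) (\<lambda>_. 0)"
  by (simp add: running_cost_def sample.emeasure_space_1)

text \<open>\<open>running_cost\<close> truncates each stage cost at 0, \<open>expected_cost\<close>
  only their sum; feasibility makes the stage costs nonnegative, so the two agree.\<close>

lemma running_cost_end:
  assumes "AE w in sample_law P. \<forall>t\<in>periods P.
     feasible_action P (inventory P \<pi> (demand w) t) (\<pi> t (history P t (demand w)))"
  shows "running_cost \<pi> (Suc (horizon P)) = expected_cost P \<pi>"
proof -
  have "running_cost \<pi> (Suc (horizon P)) = (\<integral>\<^sup>+w. (\<Sum>s\<in>periods P. ennreal (stage_cost \<pi> w s)) \<partial>sample_law P)"
    by (simp add: running_cost_def atLeastLessThanSuc_atLeastAtMost)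
  also have "\<dots> = expected_cost P \<pi>"
    unfolding expected_cost_def
  proof (rule nn_integral_cong_AE)
    show "AE w in sample_law P. (\<Sum>s\<in>periods P. ennreal (stage_cost \<pi> w s)) = ennreal (total_cost P \<pi> (demand w))"
      using assms
    proof eventually_elim
      case (elim w)
      then have "0 \<le> stage_cost \<pi> w s" if "s \<in> periods P" for s
        using that unfolding stage_cost_def by (intro period_cost_nonneg) blast
      then show ?case
        by (subst sum_ennreal) (auto simp: total_cost_def stage_cost_def)
    qed
  qed
  finally show ?thesis .
qed

text \<open>Each feasible action is a candidate in the infimum defining the cost-to-go, so
  \<open>running_cost\<close> cannot decrease from one period to the next.\<close>

lemma cost_to_go_le_expected_cost:
  assumes "feasible_policy P \<pi>"
  shows "cost_to_go (horizon P) (\<lambda>_. 0) \<le> expected_cost P \<pi>"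
proof -
  have \<pi>: "measurable_policy \<pi>"
    and feas: "AE w in sample_law P. \<forall>t\<in>periods P.
     feasible_action P (inventory P \<pi> (demand w) t) (\<pi> t (history P t (demand w)))"
    using assms by (auto simp: feasible_policy_def measurable_policy_def)
  have step: "running_cost \<pi> t \<le> running_cost \<pi> (Suc t)" if t: "t \<in> periods P" for t
    unfolding running_cost_Suc[OF \<pi> t] unfolding running_cost_def
  proof (rule nn_integral_mono_AE)
    show "AE w in sample_law P.
        (\<Sum>s\<in>{1..<t}. ennreal (stage_cost \<pi> w s)) + cost_to_go (Suc (horizon P) - t) (inventory P \<pi> (demand w) t)
        \<le> (\<Sum>s\<in>{1..<t}. ennreal (stage_cost \<pi> w s)) +
          action_cost (horizon P - t) (inventory P \<pi> (demand w) t) (\<pi> t (history P t (demand w)))"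
      using feas
    proof eventually_elim
      case (elim w)
      have "Suc (horizon P) - t = Suc (horizon P - t)"
        using t by auto
      then show ?case
        using elim t by (auto simp: cost_to_go_Suc intro!: add_left_mono INF_lower feasible_action_imp_actions)
    qed
  qed
  have "running_cost \<pi> 1 \<le> running_cost \<pi> (Suc t)" if "t \<le> horizon P" for t
    using that
  proof (induction t)
    case (Suc t)
    then show ?case
      using step[of "Suc t"] by (auto intro: order_trans)
  qed simp
  from this[of "horizon P"] show ?thesis
    by (simp add: running_cost_1[simplified] running_cost_end[OF feas])
qed

text \<open>Near-optimality is needed only at the states the policy itself reaches; each period adds
  at most \<open>e\<close> to \<open>running_cost\<close>.\<close>

lemma expected_cost_le_cost_to_go:
  fixes e :: real
  assumes \<pi>: "measurable_policy \<pi>" and e: "0 \<le> e"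
    and feas: "\<And>w t. t \<in> periods P \<Longrightarrow>
      feasible_action P (inventory P \<pi> (demand w) t) (\<pi> t (history P t (demand w)))"
    and opt: "\<And>w t. t \<in> periods P \<Longrightarrow>
      action_cost (horizon P - t) (inventory P \<pi> (demand w) t) (\<pi> t (history P t (demand w)))
        \<le> cost_to_go (Suc (horizon P - t)) (inventory P \<pi> (demand w) t) + ennreal e"
  shows "expected_cost P \<pi> \<le> cost_to_go (horizon P) (\<lambda>_. 0) + ennreal (horizon P * e)"
proof -
  have step: "running_cost \<pi> (Suc t) \<le> running_cost \<pi> t + ennreal e" if t: "t \<in> periods P" for t
  proof -
    let ?g = "\<lambda>w. (\<Sum>s\<in>{1..<t}. ennreal (stage_cost \<pi> w s)) +
      cost_to_go (Suc (horizon P) - t) (inventory P \<pi> (demand w) t)"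
    have g: "?g \<in> borel_measurable (sample_law P)"
      using t by (intro borel_measurable_add measurable_past_cost \<pi> measurable_cost_to_go measurable_inventory) auto
    have r: "Suc (horizon P) - t = Suc (horizon P - t)"
      using t by auto
    have "running_cost \<pi> (Suc t) \<le> (\<integral>\<^sup>+w. ?g w + ennreal e \<partial>sample_law P)"
      unfolding running_cost_Suc[OF \<pi> t]
      using opt[OF t] by (intro nn_integral_mono) (simp add: r add.assoc add_left_mono del: One_nat_def)
    also have "\<dots> = running_cost \<pi> t + ennreal e"
      unfolding running_cost_def using g by (subst nn_integral_add) (auto simp: sample.emeasure_space_1)
    finally show ?thesis .
  qed
  have "running_cost \<pi> (Suc t) \<le> running_cost \<pi> 1 + ennreal (t * e)" if "t \<le> horizon P" for t
    using that
  proof (induction t)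
    case (Suc t)
    have "running_cost \<pi> (Suc (Suc t)) \<le> running_cost \<pi> (Suc t) + ennreal e"
      using Suc.prems by (intro step) auto
    also have "\<dots> \<le> running_cost \<pi> 1 + ennreal (t * e) + ennreal e"
      using Suc by (intro add_right_mono) auto
    also have "\<dots> = running_cost \<pi> 1 + ennreal (Suc t * e)"
      using e by (simp add: add.assoc ennreal_plus[symmetric] algebra_simps del: ennreal_plus)
    finally show ?case .
  qed simp
  from this[of "horizon P"] show ?thesis
    using feas by (simp add: running_cost_1[simplified] running_cost_end)
qed

end

section \<open>Nearly optimal message-passing policies\<close>

lemma receivers_of_Warehouse: "receivers_of P Warehouse = Store ` stores P"
  by (auto simp: receivers_of_def edges_def)

text \<open>One round carries a sum over all stores to the warehouse, and since edges are updated
  after nodes, every edge can already read that sum.\<close>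

lemma gnn_one_round_universal:
  fixes c :: "feature \<Rightarrow> real" and \<phi> :: "real \<Rightarrow> real"
    and Fw :: "real \<Rightarrow> real \<Rightarrow> real" and Fb :: "real \<Rightarrow> real \<Rightarrow> real \<Rightarrow> real"
  assumes K: "1 \<le> num_stores P"
  obtains G where "gnn_wf G"
    "\<And>x. gnn_output P G 1 x (Supplier, Warehouse) =
       Fw (x Warehouse) (\<Sum>k\<in>stores P. \<phi> (c (node_feature P x (Store k))))"
    "\<And>x k. k \<in> stores P \<Longrightarrow> gnn_output P G 1 x (Warehouse, Store k) =
       Fb (x Warehouse) (\<Sum>k\<in>stores P. \<phi> (c (node_feature P x (Store k)))) (c (node_feature P x (Store k)))"
proof -
  let ?q = "sqrt (real (num_stores P))"
  \<comment> \<open>Node coordinates: 0 tags the type (1 warehouse, 2 store), 1 holds the warehouse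
    stock or the value \<open>c\<close> of a store, 2 receives the aggregate. Edge coordinates: 0 is
    the message of a store, 1 the output. The factor \<open>?q\<close> undoes the normalisation by
    the square root of the degree.\<close>
  define G :: gnn where "G = \<lparr>
    node_dim = 3,
    edge_dim = 2,
    embed_node = (\<lambda>s i. case s of
        SupplierF \<Rightarrow> 0
      | WarehouseF v h \<Rightarrow> (if i = 0 then 1 else if i = 1 then v else 0)
      | StoreF _ _ _ _ _ \<Rightarrow> (if i = 0 then 2 else if i = 1 then c s else 0)),
    embed_edge = (\<lambda>x y l i. if i = 0 \<and> y 0 = 2 then \<phi> (y 1) else 0),
    update_node = (\<lambda>x zi zo i. if i = 2 then zo 0 else 0),
    update_edge = (\<lambda>e x y i. if i \<noteq> 1 then 0
      else if y 0 = 2 then Fb (x 1) (x 2 * ?q) (y 1) else Fw (y 1) (y 2 * ?q)),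
    readout = (\<lambda>v. v 1)\<rparr>"
  have wf: "gnn_wf G"
    by (auto simp: gnn_wf_def G_def euclid_def split: feature.split)
  have card: "card (receivers_of P Warehouse) = num_stores P"
    unfolding receivers_of_Warehouse by (subst card_image) (auto simp: inj_on_def)
  have sum: "(\<Sum>j\<in>receivers_of P Warehouse. f j) = (\<Sum>k\<in>stores P. f (Store k))" for f :: "node \<Rightarrow> real"
    unfolding receivers_of_Warehouse by (subst sum.reindex) (auto simp: inj_on_def)
  have q: "?q \<noteq> 0"
    using K by simp
  have one: "message_round P G ^^ 1 = message_round P G"
    by simp
  show thesis
  proof (rule that[OF wf])
    fix x
    show "gnn_output P G 1 x (Supplier, Warehouse) =
       Fw (x Warehouse) (\<Sum>k\<in>stores P. \<phi> (c (node_feature P x (Store k))))"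
      using q unfolding gnn_output_def one
      by (simp add: message_round_def initial_embedding_def z_out_def card sum
          Let_def G_def node_feature_def del: One_nat_def)
    fix k assume "k \<in> stores P"
    then show "gnn_output P G 1 x (Warehouse, Store k) =
       Fb (x Warehouse) (\<Sum>k\<in>stores P. \<phi> (c (node_feature P x (Store k)))) (c (node_feature P x (Store k)))"
      using q unfolding gnn_output_def one
      by (simp add: message_round_def initial_embedding_def z_out_def card sum
          Let_def G_def node_feature_def del: One_nat_def)
  qed
qed

text \<open>\<open>inventory\<close> presupposes a policy, and a policy sees only past demands. This
  recursion computes the state under a feedback rule from the demands alone and so breaks the
  circle.\<close>

primrec closed_loop :: "inv_problem \<Rightarrow> ((node \<Rightarrow> real) \<Rightarrow> action) \<Rightarrow> demand_path \<Rightarrow> nat \<Rightarrow> node \<Rightarrow> real" where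
  "closed_loop P act d 0 = (\<lambda>_. 0)"
| "closed_loop P act d (Suc t) =
     (if t = 0 then (\<lambda>_. 0) else next_inventory P (closed_loop P act d t) (act (closed_loop P act d t)) (d t))"

lemma next_inventory_cong:
  assumes "\<And>n. n \<in> stock_nodes P \<Longrightarrow> x n = y n" "\<And>n. n \<in> stock_nodes P \<Longrightarrow> a n = b n"
    "\<And>k. k \<in> stores P \<Longrightarrow> d k = e k" "n \<in> stock_nodes P"
  shows "next_inventory P x a d n = next_inventory P y b e n"
  using assms by (cases n) auto

text \<open>Past demands determine the state, so a rule reading the state is non-anticipating. The
  history records demands of actual stores only, hence the reconstructed state is right on
  \<open>stock_nodes P\<close> and \<open>cong\<close> is required.\<close>

lemma feedback_policy:
  fixes act :: "(node \<Rightarrow> real) \<Rightarrow> action"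
  assumes cong: "\<And>x y n. (\<And>n. n \<in> stock_nodes P \<Longrightarrow> x n = y n) \<Longrightarrow> n \<in> stock_nodes P \<Longrightarrow> act x n = act y n"
    and meas: "\<And>(M :: demand_path measure) X n. (\<And>n. n \<in> stock_nodes P \<Longrightarrow> (\<lambda>w. X w n) \<in> borel_measurable M) \<Longrightarrow>
      n \<in> stock_nodes P \<Longrightarrow> (\<lambda>w. act (X w) n) \<in> borel_measurable M"
  obtains \<pi> where
    "\<And>t d n. n \<in> stock_nodes P \<Longrightarrow> \<pi> t (history P t d) n = act (inventory P \<pi> d t) n"
    "\<And>t n. n \<in> stock_nodes P \<Longrightarrow> (\<lambda>h. \<pi> t h n) \<in> borel_measurable (history_space P t)"
proof -
  define \<pi> :: policy where "\<pi> t h = act (closed_loop P act h t)" for t h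
  have history: "history P t d s k = d s k" if "s \<noteq> 0" "s < t" "k \<in> stores P" for t d s k
    using that by (simp add: history_def)
  have hist: "closed_loop P act (history P t d) s n = closed_loop P act d s n"
    if "s \<le> t" "n \<in> stock_nodes P" for s t d n
    using that
  proof (induction s arbitrary: n)
    case (Suc s)
    then have "closed_loop P act (history P t d) s m = closed_loop P act d s m" if "m \<in> stock_nodes P" for m
      using that by simp
    moreover from this have "act (closed_loop P act (history P t d) s) m = act (closed_loop P act d s) m"
      if "m \<in> stock_nodes P" for m
      using that by (intro cong) auto
    ultimately have "next_inventory P (closed_loop P act (history P t d) s) (act (closed_loop P act (history P t d) s))
        (history P t d s) n = next_inventory P (closed_loop P act d s) (act (closed_loop P act d s)) (d s) n" if "s \<noteq> 0"
      using Suc.prems that history by (intro next_inventory_cong) auto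
    then show ?case
      by simp
  qed simp
  have inv: "inventory P \<pi> d t n = closed_loop P act d t n" if "n \<in> stock_nodes P" for t d n
    using that
  proof (induction t arbitrary: n)
    case (Suc t)
    have "\<pi> t (history P t d) m = act (closed_loop P act d t) m" if "m \<in> stock_nodes P" for m
      unfolding \<pi>_def using hist[of t t] that by (intro cong) auto
    then show ?case
      using Suc by (auto intro!: next_inventory_cong)
  qed simp
  show thesis
  proof (rule that)
    fix t d n assume n: "n \<in> stock_nodes P"
    show "\<pi> t (history P t d) n = act (inventory P \<pi> d t) n"
      using n by (subst \<pi>_def) (intro cong, simp_all add: hist inv)
  next
    fix t n assume n: "n \<in> stock_nodes P"
    have "(\<lambda>h. closed_loop P act h s n) \<in> borel_measurable (history_space P t)"
      if "s \<le> t" "n \<in> stock_nodes P" for s n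
      using that
    proof (induction s arbitrary: n)
      case (Suc s)
      have h: "(\<lambda>h. h s k) \<in> borel_measurable (history_space P t)" if "s \<noteq> 0" "k \<in> stores P" for k
        unfolding history_space_def
        by (rule measurable_compose[OF measurable_component_singleton[of s] measurable_component_singleton[of k]])
          (use that Suc.prems in auto)
      have x: "(\<lambda>h. closed_loop P act h s n) \<in> borel_measurable (history_space P t)" if "n \<in> stock_nodes P" for n
        using Suc.IH[of n] Suc.prems that by simp
      have a: "(\<lambda>h. act (closed_loop P act h s) n) \<in> borel_measurable (history_space P t)" if "n \<in> stock_nodes P" for n
        using x that by (intro meas) auto
      show ?case
        using Suc.prems h x a
        by (cases "s = 0"; cases n) (auto intro!: borel_measurable_add borel_measurable_diff borel_measurable_sum)
    qed simp
    then show "(\<lambda>h. \<pi> t h n) \<in> borel_measurable (history_space P t)"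
      unfolding \<pi>_def using n by (intro meas) auto
  qed
qed

text \<open>Fewer than \<open>T\<close> additional lattice units set the clock of the warehouse to
  any wanted time.\<close>

lemma ex_add_mod_eq:
  fixes T n t :: nat
  assumes "0 < T"
  shows "\<exists>j<T. (n + j) mod T = t mod T"
proof (intro exI conjI)
  let ?j = "(t + (T - n mod T)) mod T"
  show "?j < T"
    using assms by simp
  have "(n + ?j) mod T = (n mod T + (t + (T - n mod T))) mod T"
    by (simp add: mod_simps)
  also have "n mod T + (t + (T - n mod T)) = t + T"
    using mod_less_divisor[OF assms, of n] by linarith
  finally show "(n + ?j) mod T = t mod T"
    by simp
qed

section \<open>Codes of rounded states and tables of actions\<close>

context inventory_problem
begin

text \<open>Names a tuple of real parameters by the first store that has it, so that types can enter
  a natural-number code.\<close>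

definition type_index :: "real \<times> real \<times> real \<times> real \<Rightarrow> nat" where
  "type_index \<theta> = (LEAST j. j \<in> stores P \<and> params j = \<theta>)"

lemma type_index_inj:
  assumes "j \<in> stores P" "k \<in> stores P" "type_index (params j) = type_index (params k)"
  shows "params j = params k"
proof -
  have "params (type_index (params i)) = params i" if "i \<in> stores P" for i
    using LeastI[of "\<lambda>j. j \<in> stores P \<and> params j = params i" i] that by (simp add: type_index_def)
  then show ?thesis
    using assms by metis
qed

definition code :: "int \<Rightarrow> nat \<Rightarrow> nat" where
  "code i k = prod_encode (int_encode i, type_index (params k))"

lemma code_eqD:
  assumes "code i j = code i' k" "j \<in> stores P" "k \<in> stores P"
  shows "i = i'" "params j = params k"
  using assms type_index_inj[of j k] by (auto simp: code_def dest: injD[OF inj_int_encode])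

text \<open>In base \<open>K + 1\<close> the digits count the stores with a given code, as these counts are at most \<open>K\<close>.\<close>

definition total_code :: "(nat \<Rightarrow> int) \<Rightarrow> nat" where
  "total_code g = (\<Sum>k\<in>stores P. Suc (num_stores P) ^ code (g k) k)"

lemma total_code_eqD:
  assumes "total_code g = total_code g'"
  obtains p where "p \<in> type_perms" "\<And>k. k \<in> stores P \<Longrightarrow> code (g k) k = code (g' (p k)) (p k)"
    "\<And>k. k \<in> stores P \<Longrightarrow> g k = g' (p k)"
proof -
  obtain p where p: "p permutes stores P" "\<forall>k\<in>stores P. code (g k) k = code (g' (p k)) (p k)"
    by (rule sum_power_eq_imp_permutes[OF _ _ assms[unfolded total_code_def]]) simp_all
  have "params k = params (p k)" "g k = g' (p k)" if "k \<in> stores P" for k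
    using code_eqD[OF p(2)[rule_format, OF that] that] permutes_in_image[OF p(1), of k] that by auto
  then show thesis
    using that[of p] p by (simp add: type_perms_def)
qed

definition mk_action :: "real \<Rightarrow> (nat \<Rightarrow> real) \<Rightarrow> action" where
  "mk_action w b n = (case n of Supplier \<Rightarrow> 0 | Warehouse \<Rightarrow> w | Store k \<Rightarrow> b k)"

lemma mk_action_simps [simp]:
  "mk_action w b Supplier = 0" "mk_action w b Warehouse = w" "mk_action w b (Store k) = b k"
  by (simp_all add: mk_action_def)

definition grid_state :: "real \<Rightarrow> nat \<Rightarrow> (nat \<Rightarrow> int) \<Rightarrow> node \<Rightarrow> real" where
  "grid_state \<eta> m g = mk_action (\<eta> * real m) (\<lambda>k. \<eta> * of_int (g k))"

lemma grid_state_simps [simp]: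
  "grid_state \<eta> m g Warehouse = \<eta> * real m" "grid_state \<eta> m g (Store k) = \<eta> * of_int (g k)"
  by (simp_all add: grid_state_def)

text \<open>The order \<open>w\<close> and the shipments \<open>\<alpha>\<close>, which may depend on the store only through its code, have
  to serve all rounded states with total code \<open>N\<close>; the last clause advances the clock.\<close>

definition good_table :: "real \<Rightarrow> real \<Rightarrow> nat \<Rightarrow> nat \<Rightarrow> nat \<Rightarrow> nat \<Rightarrow> real \<times> (nat \<Rightarrow> real) \<Rightarrow> bool" where
  "good_table \<eta> e r t m N = (\<lambda>(w, \<alpha>). \<forall>g. total_code g = N \<longrightarrow>
     mk_action w (\<lambda>k. \<alpha> (code (g k) k)) \<in> actions (grid_state \<eta> m g) \<and>
     action_cost r (grid_state \<eta> m g) (mk_action w (\<lambda>k. \<alpha> (code (g k) k)))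
       \<le> cost_to_go (Suc r) (grid_state \<eta> m g) + ennreal e \<and>
     (\<exists>m'. \<eta> * real m - (\<Sum>k\<in>stores P. \<alpha> (code (g k) k)) + w = \<eta> * real m' \<and>
        m' mod horizon P = t mod horizon P))"

text \<open>All rounded states with total code \<open>N\<close> are permutations of one another
  among equal stores, so a symmetric action found for one of them serves all. The summand
  \<open>L * horizon P * \<eta>\<close> pays for the enlarged order.\<close>

lemma good_table_exists:
  assumes L: "0 \<le> L" "\<And>x y a b. action_cost r x a \<le> action_cost r y b + ennreal (L * (dist1 x y + dist1 a b))"
    and \<eta>: "0 < \<eta>" and e: "0 < e"
  shows "\<exists>p. good_table \<eta> (e + L * horizon P * \<eta>) r t m N p"
proof (cases "\<exists>g. total_code g = N")
  case False
  then show ?thesis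
    by (auto simp: good_table_def)
next
  case True
  then obtain g where g: "total_code g = N" ..
  let ?x = "grid_state \<eta> m g"
  obtain a where a: "a \<in> actions ?x" "action_cost r ?x a \<le> cost_to_go (Suc r) ?x + ennreal e"
    and sym: "\<And>j k. j \<in> stores P \<Longrightarrow> k \<in> stores P \<Longrightarrow> params j = params k \<Longrightarrow> ?x (Store j) = ?x (Store k) \<Longrightarrow>
      a (Store j) = a (Store k)"
    using symmetric_near_optimal_action[of ?x e r] \<eta> e by auto
  \<comment> \<open>Any store with code \<open>i\<close> may represent it: by \<open>sym\<close>,
    stores with equal codes receive equal shipments.\<close>
  define \<alpha> where "\<alpha> i = a (Store (SOME k. k \<in> stores P \<and> code (g k) k = i))" for i
  have \<alpha>: "\<alpha> (code (g k) k) = a (Store k)" if k: "k \<in> stores P" for k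
  proof -
    define j where "j = (SOME j. j \<in> stores P \<and> code (g j) j = code (g k) k)"
    have j: "j \<in> stores P" "code (g j) j = code (g k) k"
      using someI[of "\<lambda>j. j \<in> stores P \<and> code (g j) j = code (g k) k" k] k by (auto simp: j_def)
    have "a (Store j) = a (Store k)"
      using code_eqD[OF j(2,1) k] j(1) k by (intro sym) auto
    then show ?thesis
      by (simp add: \<alpha>_def j_def)
  qed
  define l where "l = \<eta> * real m - (\<Sum>k\<in>stores P. a (Store k))"
  have l: "0 \<le> l" and aW: "0 \<le> a Warehouse"
    using a(1) \<eta> by (auto simp: actions_def l_def max_def split: if_splits)
  \<comment> \<open>\<open>l\<close> is the stock left after shipping. The lattice index is rounded
    up, since enlarging the order cannot violate a constraint.\<close>
  define n where "n = nat \<lceil>(l + a Warehouse) / \<eta>\<rceil>"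
  have n: "(l + a Warehouse) / \<eta> \<le> real n" "real n < (l + a Warehouse) / \<eta> + 1"
    using l aW \<eta> unfolding n_def by (auto simp: ceiling_correct of_nat_nat) linarith+
  obtain j where j: "j < horizon P" "(n + j) mod horizon P = t mod horizon P"
    using ex_add_mod_eq[of "horizon P" n t] horizon_pos by auto
  \<comment> \<open>The order that brings the next warehouse stock to exactly
    \<open>\<eta> * real (n + j)\<close>.\<close>
  define w where "w = \<eta> * real (n + j) - l"
  have w: "a Warehouse \<le> w" "w - a Warehouse \<le> horizon P * \<eta>"
  proof -
    have eq: "w = \<eta> * real n + \<eta> * real j - l"
      by (simp add: w_def distrib_left)
    have "l + a Warehouse \<le> \<eta> * real n" "\<eta> * real n < l + a Warehouse + \<eta>"
      using n \<eta> by (simp_all add: field_simps)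
    moreover have "0 \<le> \<eta> * real j"
      using \<eta> by simp
    \<comment> \<open>At most \<open>horizon P - 1\<close> steps for the clock and less than one
      step of rounding.\<close>
    moreover have "\<eta> * real j \<le> \<eta> * (real (horizon P) - 1)"
      using j(1) \<eta> by (intro mult_left_mono) auto
    then have "\<eta> * real j \<le> horizon P * \<eta> - \<eta>"
      by (simp add: algebra_simps)
    ultimately show "a Warehouse \<le> w" "w - a Warehouse \<le> horizon P * \<eta>"
      unfolding eq by linarith+
  qed
  let ?b = "mk_action w (\<lambda>k. a (Store k))"
  have b: "?b \<in> actions ?x"
    using a(1) w(1) aW by (auto simp: actions_def stock_nodes_def)
  have "dist1 ?x ?x + dist1 ?b a \<le> horizon P * \<eta>"
    using w by (simp add: dist1_eq)
  then have "ennreal (L * (dist1 ?x ?x + dist1 ?b a)) \<le> ennreal (L * horizon P * \<eta>)"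
    using L(1) by (intro ennreal_leI) (metis mult.assoc mult_left_mono)
  then have "action_cost r ?x ?b \<le> action_cost r ?x a + ennreal (L * horizon P * \<eta>)"
    using L(2)[of ?x ?b ?x a] by (meson add_left_mono order_trans)
  also have "\<dots> \<le> cost_to_go (Suc r) ?x + ennreal e + ennreal (L * horizon P * \<eta>)"
    using a(2) by (rule add_right_mono)
  also have "\<dots> = cost_to_go (Suc r) ?x + ennreal (e + L * horizon P * \<eta>)"
    using e L(1) \<eta> by (simp add: add.assoc)
  finally have b_opt: "action_cost r ?x ?b \<le> cost_to_go (Suc r) ?x + ennreal (e + L * horizon P * \<eta>)" .
  have "good_table \<eta> (e + L * horizon P * \<eta>) r t m N (w, \<alpha>)"
    unfolding good_table_def split_conv
  proof (intro allI impI)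
    fix g' assume "total_code g' = N"
    then obtain p where p: "p \<in> type_perms" "\<And>k. k \<in> stores P \<Longrightarrow> code (g' k) k = code (g (p k)) (p k)"
      "\<And>k. k \<in> stores P \<Longrightarrow> g' k = g (p k)"
      using total_code_eqD[of g' g] g by metis
    let ?x' = "grid_state \<eta> m g'" and ?b' = "mk_action w (\<lambda>k. \<alpha> (code (g' k) k))"
    have x': "?x' i = perm_state p ?x i" if "i \<in> stock_nodes P" for i
      using that p(3) by (cases i) auto
    have b': "?b' i = perm_state p ?b i" if "i \<in> stock_nodes P" for i
      using that p \<alpha> type_permsD(1)[OF p(1)] by (cases i) auto
    have sum: "(\<Sum>k\<in>stores P. \<alpha> (code (g' k) k)) = (\<Sum>k\<in>stores P. a (Store k))"
    proof -
      have "(\<Sum>k\<in>stores P. \<alpha> (code (g' k) k)) = (\<Sum>k\<in>stores P. a (Store (p k)))"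
        using b'[of "Store _"] by (intro sum.cong) auto
      then show ?thesis
        using sum_type_perm[OF p(1), of "\<lambda>k. a (Store k)"] by simp
    qed
    have "perm_state p ?b \<in> actions ?x'"
      using p(1) b by (rule perm_state_in_actions) simp
    then have "?b' \<in> actions ?x'"
      using b' sum sum_type_perm[OF p(1), of "\<lambda>k. a (Store k)"] by (simp add: actions_def del: One_nat_def)
    moreover have "action_cost r ?x' ?b' \<le> cost_to_go (Suc r) ?x' + ennreal (e + L * horizon P * \<eta>)"
      using b_opt action_cost_cong[of ?x' "perm_state p ?x" ?b' "perm_state p ?b" r]
        cost_to_go_cong[of ?x' "perm_state p ?x" "Suc r"] x' b'
      by (simp add: action_cost_perm[OF p(1)] cost_to_go_perm[OF p(1)])
    moreover have "\<eta> * real m - (\<Sum>k\<in>stores P. \<alpha> (code (g' k) k)) + w = \<eta> * real (n + j)"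
      unfolding sum by (simp add: w_def l_def)
    ultimately show "?b' \<in> actions ?x' \<and>
      action_cost r ?x' ?b' \<le> cost_to_go (Suc r) ?x' + ennreal (e + L * horizon P * \<eta>) \<and>
      (\<exists>m'. \<eta> * real m - (\<Sum>k\<in>stores P. \<alpha> (code (g' k) k)) + w = \<eta> * real m' \<and>
        m' mod horizon P = t mod horizon P)"
      using j(2) by blast
  qed
  then show ?thesis ..
qed

end

section \<open>Proportional allocation leaves feasible shipments unchanged\<close>

lemma proportional_allocation_eq:
  assumes "\<And>j. j \<in> stores P \<Longrightarrow> 0 \<le> b j" "(\<Sum>j\<in>stores P. b j) \<le> v" "k \<in> stores P"
  shows "proportional_allocation P v b k = b k"
proof -
  have sum: "(\<Sum>j\<in>stores P. max 0 (b j)) = (\<Sum>j\<in>stores P. b j)"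
    using assms(1) by (intro sum.cong) auto
  show ?thesis
  proof (cases "b k = 0")
    case False
    have "b k \<le> (\<Sum>j\<in>stores P. b j)"
      using assms by (intro member_le_sum) auto
    then have "1 \<le> v / (\<Sum>j\<in>stores P. b j)"
      using False assms(1)[OF assms(3)] assms(2) by simp
    then show ?thesis
      using False assms(1)[OF assms(3)] unfolding proportional_allocation_def sum by simp
  qed (simp add: proportional_allocation_def)
qed

lemma proportional_allocation_cong:
  assumes "\<And>j. j \<in> stores P \<Longrightarrow> b j = b' j" "k \<in> stores P"
  shows "proportional_allocation P v b k = proportional_allocation P v b' k"
proof -
  have "(\<Sum>j\<in>stores P. max 0 (b j)) = (\<Sum>j\<in>stores P. max 0 (b' j))"
    using assms(1) by (intro sum.cong) auto
  then show ?thesis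
    using assms by (simp add: proportional_allocation_def)
qed

lemma measurable_proportional_allocation:
  assumes v: "v \<in> borel_measurable M" and b: "\<And>j. j \<in> stores P \<Longrightarrow> (\<lambda>w. b w j) \<in> borel_measurable M"
    and k: "k \<in> stores P"
  shows "(\<lambda>w. proportional_allocation P (v w) (b w) k) \<in> borel_measurable M"
proof -
  have [measurable]: "(\<lambda>w. \<Sum>j\<in>stores P. max 0 (b w j)) \<in> borel_measurable M"
    using b by (intro borel_measurable_sum borel_measurable_max) auto
  note [measurable] = v b[OF k]
  show ?thesis
    unfolding proportional_allocation_def by measurable
qed

section \<open>The policy and its error budget\<close>

context inventory_problem
begin

lemma uniform_lipschitz:
  "\<exists>L\<ge>0. \<forall>r\<le>R. (\<forall>x y. cost_to_go r x \<le> cost_to_go r y + ennreal (L * dist1 x y)) \<and>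
     (\<forall>x y a b. action_cost r x a \<le> action_cost r y b + ennreal (L * (dist1 x y + dist1 a b)))"
proof -
  obtain L1 L2 where L1: "\<And>r. 0 \<le> L1 r" "\<And>r x y. cost_to_go r x \<le> cost_to_go r y + ennreal (L1 r * dist1 x y)"
    and L2: "\<And>r. 0 \<le> L2 r" "\<And>r x y a b. action_cost r x a \<le> action_cost r y b + ennreal (L2 r * (dist1 x y + dist1 a b))"
    using cost_to_go_lipschitz action_cost_lipschitz by metis
  define L where "L = (\<Sum>r\<le>R. L1 r + L2 r)"
  have le: "L1 r \<le> L" "L2 r \<le> L" if "r \<le> R" for r
  proof -
    have "L1 r + L2 r \<le> L"
      unfolding L_def using that L1(1) L2(1) by (intro member_le_sum) (auto intro: add_nonneg_nonneg)
    then show "L1 r \<le> L" "L2 r \<le> L"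
      using L1(1)[of r] L2(1)[of r] by linarith+
  qed
  have "cost_to_go r x \<le> cost_to_go r y + ennreal (L * dist1 x y)"
    "action_cost r x a \<le> action_cost r y b + ennreal (L * (dist1 x y + dist1 a b))" if "r \<le> R" for r x y a b
    using le[OF that]
    by (auto intro!: order_trans[OF L1(2)] order_trans[OF L2(2)] add_left_mono ennreal_leI mult_right_mono)
  moreover have "0 \<le> L"
    unfolding L_def using L1(1) L2(1) by (intro sum_nonneg) auto
  ultimately show ?thesis
    by blast
qed

text \<open>Integer-valued, because backlog makes store inventories negative.\<close>

definition cell :: "real \<Rightarrow> (node \<Rightarrow> real) \<Rightarrow> nat \<Rightarrow> int" where
  "cell \<eta> x k = \<lfloor>x (Store k) / \<eta>\<rfloor>"

lemma dist1_grid_state: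
  fixes \<eta> :: real
  assumes "0 < \<eta>" "x Warehouse = \<eta> * real m"
  shows "dist1 x (grid_state \<eta> m (cell \<eta> x)) \<le> num_stores P * \<eta>"
proof -
  have "\<bar>x (Store k) - \<eta> * of_int (cell \<eta> x k)\<bar> \<le> \<eta>" for k
  proof -
    have "of_int (cell \<eta> x k) \<le> x (Store k) / \<eta>" "x (Store k) / \<eta> \<le> of_int (cell \<eta> x k) + 1"
      unfolding cell_def by linarith+
    then have "\<eta> * of_int (cell \<eta> x k) \<le> x (Store k)" "x (Store k) \<le> \<eta> * of_int (cell \<eta> x k) + \<eta>"
      using assms(1) by (simp_all add: field_simps)
    then show ?thesis
      by linarith
  qed
  then have "(\<Sum>k\<in>stores P. \<bar>x (Store k) - \<eta> * of_int (cell \<eta> x k)\<bar>) \<le> (\<Sum>k\<in>stores P. \<eta>)"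
    by (intro sum_mono)
  then show ?thesis
    using assms(2) by (simp add: dist1_eq)
qed

text \<open>Rounding is paid for twice, in the action cost and in the cost-to-go, hence
  \<open>2 * L * num_stores P * \<eta>\<close>. Feasibility carries over exactly: it involves only
  the warehouse stock, which is on the lattice already.\<close>

lemma good_table_near_optimal:
  assumes L: "0 \<le> L" "\<And>x y. cost_to_go (Suc r) x \<le> cost_to_go (Suc r) y + ennreal (L * dist1 x y)"
    "\<And>x y a b. action_cost r x a \<le> action_cost r y b + ennreal (L * (dist1 x y + dist1 a b))"
    and \<eta>: "0 < \<eta>" and e: "0 \<le> e" and x: "x Warehouse = \<eta> * real m"
    and table: "good_table \<eta> e r t m (total_code (cell \<eta> x)) (w, \<alpha>)"
  defines "a \<equiv> mk_action w (\<lambda>k. \<alpha> (code (cell \<eta> x k) k))"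
  shows "feasible_action P x a"
    "action_cost r x a \<le> cost_to_go (Suc r) x + ennreal (e + 2 * L * num_stores P * \<eta>)"
    "\<exists>m'. x Warehouse + a Warehouse - (\<Sum>k\<in>stores P. a (Store k)) = \<eta> * real m' \<and>
        m' mod horizon P = t mod horizon P"
proof -
  let ?y = "grid_state \<eta> m (cell \<eta> x)"
  have y: "a \<in> actions ?y" "action_cost r ?y a \<le> cost_to_go (Suc r) ?y + ennreal e"
    and lattice: "\<exists>m'. \<eta> * real m - (\<Sum>k\<in>stores P. \<alpha> (code (cell \<eta> x k) k)) + w = \<eta> * real m' \<and>
        m' mod horizon P = t mod horizon P"
    using table unfolding good_table_def a_def by auto
  have "a \<in> actions x"
    using y(1) x by (simp add: actions_def)
  then show "feasible_action P x a"
    using x \<eta> by (intro actions_imp_feasible_action) auto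
  show "\<exists>m'. x Warehouse + a Warehouse - (\<Sum>k\<in>stores P. a (Store k)) = \<eta> * real m' \<and>
        m' mod horizon P = t mod horizon P"
    using lattice by (simp add: a_def x algebra_simps)
  let ?d = "L * num_stores P * \<eta>"
  have d: "L * dist1 x ?y \<le> ?d" "L * dist1 ?y x \<le> ?d"
    using mult_left_mono[OF dist1_grid_state[where x = x, OF \<eta> x] L(1)] by (simp_all add: mult.assoc dist1_commute)
  have "dist1 a a = 0"
    by (simp add: dist1_def)
  then have "L * (dist1 x ?y + dist1 a a) \<le> ?d"
    using d(1) by simp
  then have "action_cost r x a \<le> action_cost r ?y a + ennreal ?d"
    by (intro order_trans[OF L(3)[of x a ?y a]] add_left_mono ennreal_leI)
  also have "\<dots> \<le> cost_to_go (Suc r) ?y + ennreal e + ennreal ?d"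
    using y(2) by (rule add_right_mono)
  also have "\<dots> \<le> cost_to_go (Suc r) x + ennreal ?d + ennreal e + ennreal ?d"
    using d(2) by (intro add_right_mono order_trans[OF L(2)[of ?y x]] add_left_mono ennreal_leI)
  also have "\<dots> = cost_to_go (Suc r) x + ennreal (e + 2 * L * num_stores P * \<eta>)"
  proof -
    have "0 \<le> ?d"
      using L(1) \<eta> by simp
    then have "ennreal ?d + (ennreal e + ennreal ?d) = ennreal (?d + (e + ?d))"
      using e by (metis ennreal_plus add_nonneg_nonneg)
    also have "?d + (e + ?d) = e + 2 * L * num_stores P * \<eta>"
      by simp
    finally show ?thesis
      by (simp add: add.assoc)
  qed
  finally show "action_cost r x a \<le> cost_to_go (Suc r) x + ennreal (e + 2 * L * num_stores P * \<eta>)" .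
qed

lemma feasible_action_cong:
  assumes "\<And>n. n \<in> stock_nodes P \<Longrightarrow> a n = b n"
  shows "feasible_action P x a \<longleftrightarrow> feasible_action P x b"
proof -
  have "(\<Sum>k\<in>stores P. a (Store k)) = (\<Sum>k\<in>stores P. b (Store k))"
    using assms by (intro sum.cong) auto
  then show ?thesis
    using assms by (simp add: feasible_action_def)
qed

text \<open>The code of a store computed from its own feature vector alone, as an embedding must
  do.\<close>

definition cell_feature :: "real \<Rightarrow> feature \<Rightarrow> real" where
  "cell_feature \<eta> f = (case f of
      StoreF v ul uh p h \<Rightarrow> real (prod_encode (int_encode \<lfloor>v / \<eta>\<rfloor>, type_index (ul, uh, p, h)))
    | _ \<Rightarrow> 0)"

lemma cell_feature_Store: "cell_feature \<eta> (node_feature P x (Store k)) = real (code (cell \<eta> x k) k)"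
  by (simp add: cell_feature_def node_feature_def code_def cell_def params_def)

proposition near_optimal_gnn_policy:
  assumes \<epsilon>: "0 < \<epsilon>"
  obtains \<pi> where "gnn_policy P 1 \<pi>" "feasible_policy P \<pi>"
    "expected_cost P \<pi> \<le> cost_to_go (horizon P) (\<lambda>_. 0) + ennreal \<epsilon>"
proof -
  let ?T = "horizon P" and ?K = "num_stores P"
  obtain L where L: "0 \<le> L"
    "\<And>r x y. r \<le> ?T \<Longrightarrow> cost_to_go r x \<le> cost_to_go r y + ennreal (L * dist1 x y)"
    "\<And>r x y a b. r \<le> ?T \<Longrightarrow> action_cost r x a \<le> action_cost r y b + ennreal (L * (dist1 x y + dist1 a b))"
  proof -
    obtain L where "0 \<le> L" and L: "\<forall>r\<le>?T. (\<forall>x y. cost_to_go r x \<le> cost_to_go r y + ennreal (L * dist1 x y)) \<and>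
       (\<forall>x y a b. action_cost r x a \<le> action_cost r y b + ennreal (L * (dist1 x y + dist1 a b)))"
      using uniform_lipschitz[of ?T] by auto
    show thesis
      by (rule that[OF \<open>0 \<le> L\<close>]) (use L in auto)
  qed
  define e where "e = \<epsilon> / ?T"
  define c where "c = L * ?T + 2 * L * ?K"
  \<comment> \<open>Chosen so that \<open>c * \<eta>\<close> uses at most half of the budget
    \<open>e\<close> of one period; \<open>c + 1\<close> is positive even if
    \<open>c = 0\<close>.\<close>
  define \<eta> where "\<eta> = e / (2 * (c + 1))"
  have e: "0 < e"
    using \<epsilon> horizon_pos by (simp add: e_def)
  have c: "0 \<le> c"
    using L(1) by (simp add: c_def)
  have \<eta>: "0 < \<eta>"
    using e c by (simp add: \<eta>_def)
  have budget: "e / 2 + L * ?T * \<eta> + 2 * L * ?K * \<eta> \<le> e"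
  proof -
    have "c * \<eta> \<le> (c + 1) * \<eta>"
      using \<eta> by simp
    also have "\<dots> = e / 2"
      using c by (simp add: \<eta>_def field_simps)
    finally show ?thesis
      by (simp add: c_def algebra_simps)
  qed
  define e' where "e' = e / 2 + L * ?T * \<eta>"
  have e': "0 \<le> e'"
    using e L(1) \<eta> by (simp add: e'_def)
  \<comment> \<open>The residue is one less than the period: the initial stock 0 has index 0 and
    belongs to period 1.\<close>
  define period where "period m = Suc (m mod ?T)" for m
  have period: "period m \<in> periods P" for m
    using horizon_pos mod_less_divisor[of ?T m] by (simp add: period_def Suc_le_eq)
  have "\<exists>p. good_table \<eta> e' (?T - period m) (period m) m N p" for m N
    unfolding e'_def by (rule good_table_exists[OF L(1) L(3) \<eta>]) (use e in auto)
  then obtain tab where tab: "\<And>m N. good_table \<eta> e' (?T - period m) (period m) m N (tab m N)"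
    by metis
  \<comment> \<open>On the lattice this is the exact index; elsewhere the floor merely makes the
    rule total and measurable.\<close>
  define m where "m x = nat \<lfloor>x Warehouse / \<eta>\<rfloor>" for x :: "node \<Rightarrow> real"
  define N where "N x = total_code (cell \<eta> x)" for x
  define b where "b x k = snd (tab (m x) (N x)) (code (cell \<eta> x k) k)" for x k
  obtain G where G: "gnn_wf G"
    "\<And>x. gnn_output P G 1 x (Supplier, Warehouse) = fst (tab (m x) (N x))"
    "\<And>x k. k \<in> stores P \<Longrightarrow> gnn_output P G 1 x (Warehouse, Store k) = b x k"
  proof -
    \<comment> \<open>Messages are real numbers, so the natural numbers they carry are read back
      with \<open>nat\<close> and floor.\<close>
    obtain G where G: "gnn_wf G"
      "\<And>x. gnn_output P G 1 x (Supplier, Warehouse) =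
        fst (tab (nat \<lfloor>x Warehouse / \<eta>\<rfloor>)
          (nat \<lfloor>\<Sum>k\<in>stores P. real (Suc ?K ^ nat \<lfloor>cell_feature \<eta> (node_feature P x (Store k))\<rfloor>)\<rfloor>))"
      "\<And>x k. k \<in> stores P \<Longrightarrow> gnn_output P G 1 x (Warehouse, Store k) =
        snd (tab (nat \<lfloor>x Warehouse / \<eta>\<rfloor>)
          (nat \<lfloor>\<Sum>k\<in>stores P. real (Suc ?K ^ nat \<lfloor>cell_feature \<eta> (node_feature P x (Store k))\<rfloor>)\<rfloor>))
          (nat \<lfloor>cell_feature \<eta> (node_feature P x (Store k))\<rfloor>)"
      by (rule gnn_one_round_universal[OF num_stores_pos,
            where c = "cell_feature \<eta>" and \<phi> = "\<lambda>v. real (Suc ?K ^ nat \<lfloor>v\<rfloor>)"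
              and Fw = "\<lambda>v z. fst (tab (nat \<lfloor>v / \<eta>\<rfloor>) (nat \<lfloor>z\<rfloor>))"
              and Fb = "\<lambda>v z i. snd (tab (nat \<lfloor>v / \<eta>\<rfloor>) (nat \<lfloor>z\<rfloor>)) (nat \<lfloor>i\<rfloor>)"]) (rule that, assumption+)
    have N: "nat \<lfloor>\<Sum>k\<in>stores P. real (Suc ?K ^ nat \<lfloor>cell_feature \<eta> (node_feature P x (Store k))\<rfloor>)\<rfloor> = N x" for x
    proof -
      have "(\<Sum>k\<in>stores P. real (Suc ?K ^ nat \<lfloor>cell_feature \<eta> (node_feature P x (Store k))\<rfloor>)) = real (N x)"
        unfolding cell_feature_Store N_def total_code_def by (simp only: floor_of_nat nat_int of_nat_sum)
      then show ?thesis
        by (simp only: floor_of_nat nat_int)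
    qed
    show thesis
    proof (rule that[OF G(1)])
      fix x
      show "gnn_output P G 1 x (Supplier, Warehouse) = fst (tab (m x) (N x))"
        using G(2)[of x] unfolding N m_def .
      fix k assume k: "k \<in> stores P"
      show "gnn_output P G 1 x (Warehouse, Store k) = b x k"
        using G(3)[OF k, of x] unfolding N unfolding b_def m_def cell_feature_Store floor_of_nat nat_int .
    qed
  qed
  define act where "act = gnn_action P G 1"
  have act_W: "act x Warehouse = fst (tab (m x) (N x))" for x
    by (simp add: act_def gnn_action_def G(2)[simplified])
  have act_S: "act x (Store k) = proportional_allocation P (x Warehouse) (b x) k" if "k \<in> stores P" for x k
    using proportional_allocation_cong[of P "\<lambda>j. gnn_output P G 1 x (Warehouse, Store j)" "b x" k] G(3) that
    by (simp add: act_def gnn_action_def)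
  obtain \<pi> where \<pi>: "\<And>t d n. n \<in> stock_nodes P \<Longrightarrow> \<pi> t (history P t d) n = act (inventory P \<pi> d t) n"
    "\<And>t n. n \<in> stock_nodes P \<Longrightarrow> (\<lambda>h. \<pi> t h n) \<in> borel_measurable (history_space P t)"
  proof (rule feedback_policy[of P act])
    fix x y :: "node \<Rightarrow> real" and n
    assume xy: "\<And>n. n \<in> stock_nodes P \<Longrightarrow> x n = y n" and n: "n \<in> stock_nodes P"
    have m: "m x = m y"
      using xy by (simp add: m_def)
    have c: "cell \<eta> x k = cell \<eta> y k" if "k \<in> stores P" for k
      using xy that by (simp add: cell_def)
    have N: "N x = N y"
      unfolding N_def total_code_def using c by (intro sum.cong) auto
    show "act x n = act y n"
    proof (cases n)
      case (Store k)
      then have k: "k \<in> stores P"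
        using n by simp
      show ?thesis
        unfolding Store act_S[OF k] using xy[of Warehouse]
        by (simp, intro proportional_allocation_cong k) (simp add: b_def m N c)
    qed (use n m N act_W in auto)
  next
    fix M :: "demand_path measure" and X :: "demand_path \<Rightarrow> node \<Rightarrow> real" and n
    assume X: "\<And>n. n \<in> stock_nodes P \<Longrightarrow> (\<lambda>w. X w n) \<in> borel_measurable M" and n: "n \<in> stock_nodes P"
    have [measurable]: "(\<lambda>w. X w Warehouse) \<in> borel_measurable M"
      using X by simp
    have m[measurable]: "(\<lambda>w. m (X w)) \<in> measurable M (count_space UNIV)"
      unfolding m_def by measurable
    have code[measurable]: "(\<lambda>w. code (cell \<eta> (X w) k) k) \<in> measurable M (count_space UNIV)" if "k \<in> stores P" for k
    proof -
      have [measurable]: "(\<lambda>w. X w (Store k)) \<in> borel_measurable M"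
        using X that by simp
      show ?thesis
        unfolding code_def cell_def by measurable
    qed
    have N[measurable]: "(\<lambda>w. N (X w)) \<in> measurable M (count_space UNIV)"
    proof -
      have "(\<lambda>w. real (N (X w))) \<in> borel_measurable M"
        unfolding N_def total_code_def of_nat_sum
        by (intro borel_measurable_sum measurable_compose[OF code]) auto
      then have "(\<lambda>w. nat \<lfloor>real (N (X w))\<rfloor>) \<in> measurable M (count_space UNIV)"
        by measurable
      then show ?thesis
        by simp
    qed
    \<comment> \<open>\<open>F\<close> may be any function, as its arguments are measurable and take
      countably many values.\<close>
    have F: "(\<lambda>w. F (m (X w)) (N (X w))) \<in> borel_measurable M" for F :: "nat \<Rightarrow> nat \<Rightarrow> real"
      using m N by measurable
    show "(\<lambda>w. act (X w) n) \<in> borel_measurable M"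
    proof (cases n)
      case Warehouse
      show ?thesis
        unfolding Warehouse act_W by (rule F)
    next
      case (Store k)
      then have k: "k \<in> stores P"
        using n by simp
      have "(\<lambda>w. b (X w) j) \<in> borel_measurable M" if "j \<in> stores P" for j
        unfolding b_def
        by (rule measurable_compose_countable[OF F code[OF that]])
      then show ?thesis
        unfolding Store act_S[OF k] by (intro measurable_proportional_allocation k) auto
    qed (use n in simp)
  qed (rule that)
  have good: "feasible_action P x (act x)"
      "action_cost (?T - t) x (act x) \<le> cost_to_go (Suc (?T - t)) x + ennreal e"
      "\<exists>m'. x Warehouse + act x Warehouse - (\<Sum>k\<in>stores P. act x (Store k)) = \<eta> * real m' \<and> m' mod ?T = t mod ?T"
    if t: "t \<in> periods P" and x: "x Warehouse = \<eta> * real i" "i mod ?T = t - 1" for x t i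
  proof -
    have mi: "m x = i" and pi: "period i = t"
      using x \<eta> t by (auto simp: m_def period_def)
    let ?a = "mk_action (fst (tab i (N x))) (\<lambda>k. snd (tab i (N x)) (code (cell \<eta> x k) k))"
    have r: "Suc (?T - t) \<le> ?T" "?T - t \<le> ?T"
      using t by auto
    have "good_table \<eta> e' (?T - t) t i (total_code (cell \<eta> x)) (fst (tab i (N x)), snd (tab i (N x)))"
      using tab[of i "N x"] unfolding pi N_def by simp
    note a = good_table_near_optimal[OF L(1) L(2)[OF r(1)] L(3)[OF r(2)] \<eta> e' x(1) this]
    \<comment> \<open>The tabulated shipments are feasible, so the enforcement map does not alter
      them.\<close>
    have eq: "act x n = ?a n" if "n \<in> stock_nodes P" for n
    proof (cases n)
      case (Store k)
      then have k: "k \<in> stores P"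
        using that by simp
      show ?thesis
        unfolding Store act_S[OF k] using a(1) k
        by (subst proportional_allocation_eq) (auto simp: b_def mi feasible_action_def stock_nodes_def)
    qed (use that act_W mi in auto)
    have sum: "(\<Sum>k\<in>stores P. act x (Store k)) = (\<Sum>k\<in>stores P. ?a (Store k))"
      using eq by (intro sum.cong) auto
    show "feasible_action P x (act x)"
      using a(1) feasible_action_cong[of "act x" ?a x] eq by blast
    show "\<exists>m'. x Warehouse + act x Warehouse - (\<Sum>k\<in>stores P. act x (Store k)) = \<eta> * real m' \<and> m' mod ?T = t mod ?T"
      using a(3) unfolding sum eq[OF Warehouse_in_stock_nodes] .
    have "action_cost (?T - t) x (act x) = action_cost (?T - t) x ?a"
      using eq by (intro action_cost_cong) auto
    also have "\<dots> \<le> cost_to_go (Suc (?T - t)) x + ennreal (e' + 2 * L * ?K * \<eta>)"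
      by (rule a(2))
    also have "\<dots> \<le> cost_to_go (Suc (?T - t)) x + ennreal e"
      using budget by (intro add_left_mono ennreal_leI) (simp add: e'_def)
    finally show "action_cost (?T - t) x (act x) \<le> cost_to_go (Suc (?T - t)) x + ennreal e" .
  qed
  \<comment> \<open>At the start of period \<open>Suc t\<close> the clock shows \<open>t\<close>; as
    \<open>t < ?T\<close>, it has not yet wrapped around.\<close>
  have lattice: "\<exists>i. inventory P \<pi> d (Suc t) Warehouse = \<eta> * real i \<and> i mod ?T = t" if "t < ?T" for d t
    using that
  proof (induction t)
    case 0
    show ?case
      by (intro exI[of _ 0]) simp
  next
    case (Suc t)
    then obtain i where i: "inventory P \<pi> d (Suc t) Warehouse = \<eta> * real i" "i mod ?T = t"
      by auto
    let ?x = "inventory P \<pi> d (Suc t)"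
    obtain m' where m': "?x Warehouse + act ?x Warehouse - (\<Sum>k\<in>stores P. act ?x (Store k)) = \<eta> * real m'"
      "m' mod ?T = Suc t mod ?T"
      using good(3)[of "Suc t" ?x i] i Suc.prems by auto
    have "inventory P \<pi> d (Suc (Suc t)) Warehouse = ?x Warehouse + act ?x Warehouse - (\<Sum>k\<in>stores P. act ?x (Store k))"
      by (simp add: \<pi>(1) del: inventory.simps(2) add: inventory.simps(2)[of _ _ _ "Suc t"])
    also note m'(1)
    finally have "inventory P \<pi> d (Suc (Suc t)) Warehouse = \<eta> * real m'" .
    moreover have "m' mod ?T = Suc t"
      using m'(2) Suc.prems by simp
    ultimately show ?case
      by blast
  qed
  have good_\<pi>: "feasible_action P (inventory P \<pi> d t) (\<pi> t (history P t d))"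
      "action_cost (?T - t) (inventory P \<pi> d t) (\<pi> t (history P t d))
        \<le> cost_to_go (Suc (?T - t)) (inventory P \<pi> d t) + ennreal e"
    if t: "t \<in> periods P" for d t
  proof -
    let ?x = "inventory P \<pi> d t"
    obtain s where s: "t = Suc s" "s < ?T"
      using t by (cases t) auto
    then obtain i where i: "?x Warehouse = \<eta> * real i" "i mod ?T = t - 1"
      using lattice[OF s(2), of d] unfolding s(1) diff_Suc_1 by blast
    show "feasible_action P ?x (\<pi> t (history P t d))"
      using good(1)[of t ?x i, OF t i] feasible_action_cong[of "\<pi> t (history P t d)" "act ?x" ?x] \<pi>(1) by blast
    show "action_cost (?T - t) ?x (\<pi> t (history P t d)) \<le> cost_to_go (Suc (?T - t)) ?x + ennreal e"
      using good(2)[of t ?x i, OF t i] action_cost_cong[of ?x ?x "\<pi> t (history P t d)" "act ?x"] \<pi>(1) by simp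
  qed
  have meas: "measurable_policy \<pi>"
    using \<pi>(2) by (simp add: measurable_policy_def)
  show thesis
  proof (rule that)
    show "gnn_policy P 1 \<pi>"
      unfolding gnn_policy_def using G(1) \<pi>(1) by (auto simp: act_def)
    show "feasible_policy P \<pi>"
      unfolding feasible_policy_def using \<pi>(2) good_\<pi>(1) by auto
    have "expected_cost P \<pi> \<le> cost_to_go ?T (\<lambda>_. 0) + ennreal (?T * e)"
      using meas e good_\<pi> by (intro expected_cost_le_cost_to_go) auto
    then show "expected_cost P \<pi> \<le> cost_to_go ?T (\<lambda>_. 0) + ennreal \<epsilon>"
      using horizon_pos by (simp add: e_def)
  qed
qed

section \<open>Positivity of the optimal cost\<close>

lemma AE_draw_ge:
  assumes k: "k \<in> stores P"
  shows "AE z in period_law P. gamma_L P * u_lo P k \<le> draw z k"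
proof -
  let ?U = "\<lambda>k. uniform_measure lborel {u_lo P k..u_hi P k}"
  let ?B = "distr (measure_pmf (bernoulli_pmf (prob_high P))) borel (\<lambda>b. if b then gamma_H P else gamma_L P)"
  interpret U: prob_space "PiM (stores P) ?U"
    by (rule prob_space_U_PiM)
  interpret B: prob_space ?B
    by (rule prob_space_B)
  interpret pair_sigma_finite ?B "PiM (stores P) ?U"
    by unfold_locales
  have B: "AE b in ?B. gamma_L P \<le> b"
    using gamma_L_le_H by (subst AE_distr_iff) auto
  have "AE u in ?U k. u_lo P k \<le> u"
    using u_less[OF k] by (intro AE_uniform_measureI) auto
  then have U: "AE w in PiM (stores P) ?U. u_lo P k \<le> w k"
    using k prob_space_U by (intro AE_PiM_component) auto
  have "AE z in ?B \<Otimes>\<^sub>M PiM (stores P) ?U. gamma_L P * u_lo P k \<le> draw z k"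
  proof (rule AE_pair_measure)
    show "{z \<in> space (?B \<Otimes>\<^sub>M PiM (stores P) ?U). gamma_L P * u_lo P k \<le> draw z k} \<in> sets (?B \<Otimes>\<^sub>M PiM (stores P) ?U)"
      using measurable_draw[OF k] unfolding period_law_def by measurable
    show "AE b in ?B. AE w in PiM (stores P) ?U. gamma_L P * u_lo P k \<le> draw (b, w) k"
      using B
    proof eventually_elim
      case (elim b)
      show ?case
        using U by eventually_elim
          (use elim gamma_L_pos u_lo_pos[OF k] in \<open>auto simp: draw_def intro!: mult_mono\<close>)
    qed
  qed
  then show ?thesis
    unfolding period_law_def .
qed

text \<open>Nothing can be shipped from an empty warehouse in period 1, so store 1 almost surely
  backlogs at least \<open>gamma_L P * u_lo P 1\<close>. Positivity turns absolute errors into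
  relative ones.\<close>

lemma cost_to_go_zero_pos: "0 < cost_to_go (horizon P) (\<lambda>_. 0)"
proof -
  obtain r where r: "horizon P = Suc r"
    using horizon_pos by (cases "horizon P") auto
  have k: "1 \<in> stores P"
    using num_stores_pos by simp
  let ?c = "underage P 1 * (gamma_L P * u_lo P 1)"
  have c: "0 < ?c"
    using underage_pos[OF k] gamma_L_pos u_lo_pos[OF k] by simp
  have "ennreal ?c \<le> action_cost r (\<lambda>_. 0) a" if a: "a \<in> actions (\<lambda>_. 0)" for a
  proof -
    have nn: "\<And>k. k \<in> stores P \<Longrightarrow> 0 \<le> a (Store k)" and le: "(\<Sum>k\<in>stores P. a (Store k)) \<le> 0"
      using a by (auto simp: actions_def)
    have sum0: "(\<Sum>k\<in>stores P. a (Store k)) = 0"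
      using le nn by (intro antisym sum_nonneg) auto
    then have a0: "a (Store k) = 0" if "k \<in> stores P" for k
      using nn that by (subst (asm) sum_nonneg_eq_0_iff) auto
    have "ennreal ?c = (\<integral>\<^sup>+z. ennreal ?c \<partial>period_law P)"
      by (simp add: period.emeasure_space_1)
    also have "\<dots> \<le> action_cost r (\<lambda>_. 0) a"
      unfolding action_cost_def
    proof (rule nn_integral_mono_AE)
      show "AE z in period_law P. ennreal ?c
          \<le> ennreal (period_cost P (\<lambda>_. 0) a (draw z)) + cost_to_go r (next_inventory P (\<lambda>_. 0) a (draw z))"
        using AE_draw_ge[OF k]
      proof eventually_elim
        case (elim z)
        let ?g = "\<lambda>k. underage P k * max 0 (draw z k) + holding P k * max 0 (- draw z k)"
        have "?c \<le> underage P 1 * draw z 1"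
          using elim underage_pos[OF k] by simp
        also have "\<dots> \<le> ?g 1"
        proof -
          have "underage P 1 * draw z 1 \<le> underage P 1 * max 0 (draw z 1)"
            using underage_pos[OF k] by (intro mult_left_mono) auto
          moreover have "0 \<le> holding P 1 * max 0 (- draw z 1)"
            using holding_nonneg[OF k] by simp
          ultimately show ?thesis
            by linarith
        qed
        also have "\<dots> \<le> (\<Sum>k\<in>stores P. ?g k)"
        proof (rule member_le_sum[OF k])
          fix j assume "j \<in> stores P - {1}"
          then show "0 \<le> ?g j"
            using underage_pos[of j] holding_nonneg[of j] by (intro add_nonneg_nonneg mult_nonneg_nonneg) auto
        qed simp
        also have "\<dots> = period_cost P (\<lambda>_. 0) a (draw z)"
          unfolding period_cost_def sum0 using a0 by (simp del: One_nat_def)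
        finally show ?case
          by (intro add_increasing2 ennreal_leI) auto
      qed
    qed
    finally show ?thesis .
  qed
  then have "ennreal ?c \<le> cost_to_go (horizon P) (\<lambda>_. 0)"
    unfolding r cost_to_go_Suc by (rule INF_greatest)
  then show ?thesis
    using c by (metis ennreal_less_zero_iff order_less_le_trans)
qed

end

text \<open>\<open>u_lo P k\<close> is positive because twice \<open>\<gamma>L * u_lo P k\<close> is
  at least \<open>\<gamma>H * u_hi P k\<close>, which is positive.\<close>

lemma admissible_imp_inventory_problem:
  assumes "0 < p_lo" "0 < h_lo" "1 \<le> \<kappa>" "0 < \<gamma>L" "\<gamma>L < \<gamma>H"
    and P: "admissible p_lo p_hi h_lo h_hi q \<kappa> \<gamma>L \<gamma>H P"
  shows "inventory_problem P"
proof
  have G: "gamma_L P = \<gamma>L" "gamma_H P = \<gamma>H"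
    using P by (auto simp: admissible_def)
  show "1 \<le> num_stores P" "1 \<le> horizon P" "0 \<le> holding_w P"
    using P by (auto simp: admissible_def)
  show "0 < gamma_L P" "gamma_L P \<le> gamma_H P"
    using G assms by auto
  fix k assume "k \<in> stores P"
  then have k: "p_lo \<le> underage P k" "h_lo \<le> holding P k" "u_lo P k < u_hi P k" "1 / \<kappa> \<le> u_hi P k"
    "\<gamma>H * u_hi P k - \<gamma>L * u_lo P k \<le> \<gamma>L * u_lo P k"
    using P by (auto simp: admissible_def)
  show "u_lo P k < u_hi P k" "0 < underage P k" "0 \<le> holding P k"
    using k assms by auto
  have "0 < 1 / \<kappa>"
    using assms by simp
  then have "0 < u_hi P k"
    using k(4) by linarith
  then have "0 < \<gamma>H * u_hi P k"
    using assms by (intro mult_pos_pos) auto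
  then have "0 < \<gamma>L * u_lo P k"
    using k(5) by linarith
  then show "0 < u_lo P k"
    using assms by (simp add: zero_less_mult_iff)
qed

theorem theorem1:
  fixes p_lo p_hi h_lo h_hi q \<kappa> \<gamma>L \<gamma>H :: real
  assumes "0 < p_lo" "p_lo \<le> p_hi" "0 < h_lo" "h_lo \<le> h_hi"
    and "0 < q" "q < 1" and "1 \<le> \<kappa>" and "0 < \<gamma>L" "\<gamma>L < \<gamma>H"
  shows "\<exists>C::real. \<forall>P. admissible p_lo p_hi h_lo h_hi q \<kappa> \<gamma>L \<gamma>H P \<longrightarrow>
           (\<exists>\<pi>. gnn_policy P 1 \<pi> \<and> feasible_policy P \<pi> \<and>
              expected_cost P \<pi> / (INF \<pi>'\<in>{\<pi>'. feasible_policy P \<pi>'}. expected_cost P \<pi>')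
                \<le> ennreal (1 + C / sqrt (real (num_stores P))))"
\<comment> \<open>The absolute error is at our disposal; a fraction \<open>1 / sqrt K\<close> of the
  optimal cost-to-go gives the constant 1.\<close>
proof (intro exI[of _ 1] allI impI)
  fix P assume "admissible p_lo p_hi h_lo h_hi q \<kappa> \<gamma>L \<gamma>H P"
  then interpret inventory_problem P
    using assms by (intro admissible_imp_inventory_problem)
  define V where "V = cost_to_go (horizon P) (\<lambda>_. 0)"
  let ?J = "INF \<pi>'\<in>{\<pi>'. feasible_policy P \<pi>'}. expected_cost P \<pi>'"
  have "0 < V"
    unfolding V_def by (rule cost_to_go_zero_pos)
  have V_le: "V \<le> ?J"
    unfolding V_def by (rule INF_greatest) (simp add: cost_to_go_le_expected_cost)
  show "\<exists>\<pi>. gnn_policy P 1 \<pi> \<and> feasible_policy P \<pi> \<and>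
      expected_cost P \<pi> / ?J \<le> ennreal (1 + 1 / sqrt (real (num_stores P)))"
  proof (cases "V = \<top>")
    \<comment> \<open>Division by infinity gives 0 in \<open>ennreal\<close>, so any feasible
      message-passing policy will do.\<close>
    case True
    then have "?J = \<top>"
      using V_le by (simp add: top_unique)
    moreover obtain \<pi> where "gnn_policy P 1 \<pi>" "feasible_policy P \<pi>"
      using near_optimal_gnn_policy[of 1] by auto
    ultimately show ?thesis
      by auto
  next
    case False
    define v where "v = enn2real V"
    have V: "V = ennreal v" "0 < v"
      using False \<open>0 < V\<close> by (simp_all add: v_def less_top[symmetric] enn2real_positive_iff)
    let ?s = "sqrt (real (num_stores P))"
    have s: "0 < ?s"
      using num_stores_pos by simp
    obtain \<pi> where \<pi>: "gnn_policy P 1 \<pi>" "feasible_policy P \<pi>" "expected_cost P \<pi> \<le> V + ennreal (v / ?s)"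
      using near_optimal_gnn_policy[of "v / ?s"] V(2) s unfolding V_def by auto
    have "expected_cost P \<pi> / ?J \<le> ennreal (v + v / ?s) / ?J"
      using \<pi>(3) V s by (intro divide_right_mono_ennreal) simp
    also have "\<dots> \<le> ennreal (1 + 1 / ?s)"
    proof (cases ?J)
      case (real j)
      then have j: "v \<le> j" "0 < j"
        using V_le V by (simp_all add: ennreal_le_iff2)
      \<comment> \<open>The cost bound is relative to \<open>v\<close>, which is at most the infimum
        \<open>j\<close>.\<close>
      have "(v + v / ?s) / j \<le> (v + v / ?s) / v"
        using j V(2) s by (intro divide_left_mono) auto
      also have "\<dots> = 1 + 1 / ?s"
        using V(2) by (simp add: add_divide_distrib)
      finally show ?thesis
        using j V(2) s by (simp add: real(2) divide_ennreal ennreal_leI del: ennreal_plus)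
    qed simp
    finally show ?thesis
      using \<pi>(1,2) by blast
  qed
qed

end
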